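(* Let $\alpha\in\mathbb{R}$, $1<p,q<\infty$, $0<\lambda<\min\{\alpha+n/p,\alpha+m/p\}$, and $$\max\left\{-\frac np,-\frac mp\right\}<\alpha<\min\left\{n\left(1-\frac1p\right),m\left(1-\frac1p\right)\right\}.$$ Then, on $\operatorname{bmo}(\mathbb{R}^n\times\mathbb{R}^m)$ modulo constants, the norms $\|\cdot\|_{\mathrm{bmo}_{M\vec{\dot K}_{p,q}^{\alpha,\lambda}}(\mathbb{R}^n\times\mathbb{R}^m)}$ and $\|\cdot\|_{\mathrm{bmo}(\mathbb{R}^n\times\mathbb{R}^m)}$ are equivalent, i.e. there is a constant $C\geq1$ such that for all $f\in\operatorname{bmo}(\mathbb{R}^n\times\mathbb{R}^m)$, $$C^{-1}\|f\|_{\mathrm{bmo}(\mathbb{R}^n\times\mathbb{R}^m)}\le\|f\|_{\mathrm{bmo}_{M\vec{\dot K}_{p,q}^{\alpha,\lambda}}(\mathbb{R}^n\times\mathbb{R}^m)}\le C\|f\|_{\mathrm{bmo}(\mathbb{R}^n\times\mathbb{R}^m)}.$$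
   Context: $n,m$ are positive integers. For $x\in\mathbb{R}^d$, $r>0$, $Q(x,r)$ is the cube centered at $x$ with side length $r$; $\mathcal{R}$ is the set of all $Q(x,r)\times Q(y,s)$, $x\in\mathbb{R}^n$, $y\in\mathbb{R}^m$, $r,s>0$. With $f_R=\frac1{|R|}\int_Rf(z)\,dz$, a locally integrable $f$ belongs to little bmo, $\operatorname{bmo}(\mathbb{R}^n\times\mathbb{R}^m)$, if $$\|f\|_{\mathrm{bmo}(\mathbb{R}^n\times\mathbb{R}^m)}=\sup_{R\in\mathcal{R}}\frac{\|(f-f_R)\chi_R\|_{L^1}}{\|\chi_R\|_{L^1}}<\infty.$$ Also $$\|f\|_{\mathrm{bmo}_{M\vec{\dot K}_{p,q}^{\alpha,\lambda}}(\mathbb{R}^n\times\mathbb{R}^m)}=\sup_{R\in\mathcal{R}}\frac{\|(f-f_R)\chi_R\|_{M\vec{\dot K}_{p,q}^{\alpha,\lambda}}}{\|\chi_R\|_{M\vec{\dot K}_{p,q}^{\alpha,\lambda}}}.$$ For $k\in\mathbb{Z}$, $Q_k=Q(0,2^k)$ (in $\mathbb{R}^n$ or $\mathbb{R}^m$); $R_{i,j}=Q_i\times Q_j$; $I_i=Q_i\setminus Q_{i-1}\subset\mathbb{R}^n$, $J_j=Q_j\setminus Q_{j-1}\subset\mathbb{R}^m$; $\chi_{i,j}$ is the characteristic function of $I_i\times J_j$. For measurable $f$, $$\|f\|_{\vec{\dot K}_{p,q}^{\alpha}}=\Big(\sum_{i,j\in\mathbb{Z}}2^{(i+j)q\alpha}\|f\chi_{i,j}\|_{L^p(\mathbb{R}^n\times\mathbb{R}^m)}^q\Big)^{1/q},\qquad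 \|f\|_{M\vec{\dot K}_{p,q}^{\alpha,\lambda}}=\sup_{L_1,L_2\in\mathbb{Z}}2^{-(L_1+L_2)\lambda}\|f\chi_{R_{L_1,L_2}}\|_{\vec{\dot K}_{p,q}^{\alpha}}.$$ *)

theory Defs
  imports "HOL-Analysis.Analysis"
begin

text \<open>
  Functions live on \<^typ>\<open>(real^'n) \<times> (real^'m)\<close>, with \<open>n = CARD('n)\<close> and \<open>m = CARD('m)\<close>.  All
  norms are \<^typ>\<open>ennreal\<close>-valued, so every supremum, series and integral below is meaningful
  without a finiteness assumption.
\<close>

definition cube :: "real^'n \<Rightarrow> real \<Rightarrow> (real^'n) set" where
  "cube x r = cbox (\<chi> i. x $ i - r / 2) (\<chi> i. x $ i + r / 2)"

definition rectangles :: "((real^'n) \<times> (real^'m)) set set" where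
  "rectangles = {cube x r \<times> cube y s | x r y s. r > 0 \<and> s > 0}"

definition dyadic_cube :: "int \<Rightarrow> (real^'n) set" where
  "dyadic_cube k = cube 0 (2 powi k)"

definition dyadic_shell :: "int \<Rightarrow> (real^'n) set" where
  "dyadic_shell k = dyadic_cube k - dyadic_cube (k - 1)"

definition cut :: "'a set \<Rightarrow> ('a \<Rightarrow> 'v::real_vector) \<Rightarrow> 'a \<Rightarrow> 'v" where
  "cut A f = (\<lambda>z. indicator A z *\<^sub>R f z)"

text \<open>Real powers on \<open>[0, \<infinity>]\<close>; only used with exponent \<open>a > 0\<close>.\<close>

definition ennpowr :: "ennreal \<Rightarrow> real \<Rightarrow> ennreal" where
  "ennpowr x a = (if x = \<infinity> then \<infinity> else ennreal (enn2real x powr a))"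

definition Lp_norm :: "real \<Rightarrow> ('a::euclidean_space \<Rightarrow> 'v::real_normed_vector) \<Rightarrow> ennreal" where
  "Lp_norm p f = ennpowr (\<integral>\<^sup>+z. ennreal (norm (f z) powr p) \<partial>lebesgue) (1 / p)"

definition herz_norm ::
  "real \<Rightarrow> real \<Rightarrow> real \<Rightarrow> ((real^'n) \<times> (real^'m) \<Rightarrow> 'v::real_normed_vector) \<Rightarrow> ennreal" where
  "herz_norm \<alpha> p q f =
     ennpowr (\<Sum>\<^sub>\<infinity>(i, j)\<in>UNIV. ennreal (2 powr (real_of_int (i + j) * q * \<alpha>)) *
                ennpowr (Lp_norm p (cut (dyadic_shell i \<times> dyadic_shell j) f)) q) (1 / q)"

definition morrey_herz_norm ::
  "real \<Rightarrow> real \<Rightarrow> real \<Rightarrow> real \<Rightarrow> ((real^'n) \<times> (real^'m) \<Rightarrow> 'v::real_normed_vector) \<Rightarrow> ennreal" where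
  "morrey_herz_norm \<alpha> lam p q f =
     (SUP (L1, L2)\<in>UNIV. ennreal (2 powr (- real_of_int (L1 + L2) * lam)) *
        herz_norm \<alpha> p q (cut (dyadic_cube L1 \<times> dyadic_cube L2) f))"

definition average ::
  "('a::euclidean_space) set \<Rightarrow> ('a \<Rightarrow> 'v::{banach, second_countable_topology}) \<Rightarrow> 'v" where
  "average R f = (1 / measure lebesgue R) *\<^sub>R (LINT z:R|lebesgue. f z)"

definition bmo_norm ::
  "((real^'n) \<times> (real^'m) \<Rightarrow> 'v::{banach, second_countable_topology}) \<Rightarrow> ennreal" where
  "bmo_norm f =
     (SUP R\<in>rectangles. Lp_norm 1 (cut R (\<lambda>z. f z - average R f)) /
        Lp_norm 1 (indicator R :: _ \<Rightarrow> real))"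

text \<open>
  For \<open>0 < lam < min (\<alpha> + n/p) (\<alpha> + m/p)\<close> the denominator lies strictly between \<open>0\<close> and \<open>\<infinity>\<close>, so
  the conventions of \<^typ>\<open>ennreal\<close> for division by \<open>0\<close> and \<open>\<infinity>\<close> play no role.
\<close>

definition bmo_morrey_herz_norm ::
  "real \<Rightarrow> real \<Rightarrow> real \<Rightarrow> real \<Rightarrow>
   ((real^'n) \<times> (real^'m) \<Rightarrow> 'v::{banach, second_countable_topology}) \<Rightarrow> ennreal" where
  "bmo_morrey_herz_norm \<alpha> lam p q f =
     (SUP R\<in>rectangles. morrey_herz_norm \<alpha> lam p q (cut R (\<lambda>z. f z - average R f)) /
        morrey_herz_norm \<alpha> lam p q (indicator R :: _ \<Rightarrow> real))"

definition locally_integrable ::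
  "('a::euclidean_space \<Rightarrow> 'v::{banach, second_countable_topology}) \<Rightarrow> bool" where
  "locally_integrable f \<longleftrightarrow> (\<forall>K. compact K \<longrightarrow> set_integrable lebesgue K f)"

definition bmo :: "((real^'n) \<times> (real^'m) \<Rightarrow> complex) set" where
  "bmo = {f. locally_integrable f \<and> bmo_norm f < \<infinity>}"

end

theory Submission
  imports Defs
begin

text \<open>
  Both inequalities compare a rectangle \<open>R = A \<times> B\<close> with the shells it meets.  If \<open>K\<close> is the least
  scale with \<open>A \<subseteq> Q\<^sub>K\<close>, then \<open>A\<close> meets no shell beyond \<open>K\<close>, its part in the shell \<open>i \<le> K\<close> has measure
  \<open>O(|A| 2\<^bsup>(i-K)n\<^esup>)\<close>, and a fixed fraction of \<open>A\<close> lies in the shells \<open>K\<close> and \<open>K - 1\<close>.  Hence the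
  Morrey-Herz norm of \<open>\<chi>\<^sub>R\<close> is comparable to \<open>|R|\<^bsup>1/p\<^esup> 2\<^bsup>(K\<^sub>1+K\<^sub>2)(\<alpha>-\<lambda>)\<^esup>\<close>, and all sums over shells are geometric:
  with ratio governed by \<open>\<alpha> + n/p - \<lambda> > 0\<close> for the upper bound and by \<open>n(1 - 1/p) - \<alpha> > 0\<close> for the lower one.
  The upper bound needs the \<open>L\<^sup>s\<close> form of the John-Nirenberg inequality for little bmo for a large \<open>s > p\<close>;
  it follows by dyadic bisection because halving both sides of a rectangle gives rectangles again.
  The lower bound is Hoelder's inequality on each shell.
\<close>

section \<open>The John-Nirenberg inequality on bisected boxes\<close>

text \<open>The exponential estimate is proved for means over dyadic boxes. Passing from the means
  to \<open>f\<close> itself would usually take Lebesgue's differentiation theorem. Here it is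
  replaced by a weaker fact: for every e > 0 some generation of boxes has total oscillation at most
  e. This follows from L1 approximation by continuous functions. The passage works only for
  Lipschitz functions of \<open>f\<close>, so the exponential is truncated at a level N. The
  resulting bound does not depend on N, and Fatou's lemma removes the truncation.

  The exponent s = pt must be large because Hoelder's inequality on a shell weakens the decay
  exponent n/p of its L^p norm to n(1 - 1/t)/p. The strict inequality \<lambda> < \<alpha> + n/p
  leaves room for a finite t, but not for an arbitrary one.

  Two shells, K and K - 1, enter the lower estimate of the denominator because a cube may protrude
  from the dyadic cube of scale K - 1 by an arbitrarily thin margin.\<close>

lemma continuous_L1_approx:
  fixes f :: "'a::euclidean_space \<Rightarrow> 'v::{banach, second_countable_topology}"
  assumes "integrable lebesgue f" "e > 0"
  shows "\<exists>g. continuous_on UNIV g \<and> integrable lebesgue g \<and> (LINT z|lebesgue. norm (f z - g z)) \<le> e"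
  using assms
proof (induction arbitrary: e rule: integrable_induct)
  case (base A c)
  have "e / (1 + norm c) > 0" using base by (simp add: add_pos_nonneg)
  \<comment> \<open>Chosen so that \<open>2 * d * norm c\<close> is at most \<open>e\<close>; the
    summand 1 covers \<open>c = 0\<close>.\<close>
  define d where "d = e / (1 + norm c) / 2"
  have d: "d > 0" using base by (simp add: d_def add_pos_nonneg)
  obtain T where T: "closed T" "T \<subseteq> A" "A - T \<in> lmeasurable" "emeasure lebesgue (A - T) < ennreal d"
    using sets_lebesgue_inner_closed[OF base(1) d] by metis
  obtain U where U: "open U" "A \<subseteq> U" "U - A \<in> lmeasurable" "emeasure lebesgue (U - A) < ennreal d"
    using sets_lebesgue_outer_open[OF base(1) d] by metis
  obtain u :: "'a \<Rightarrow> real" where u: "continuous_on UNIV u" "\<And>x. u x \<in> closed_segment 0 1"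
      "\<And>x. x \<in> - U \<Longrightarrow> u x = 0" "\<And>x. x \<in> T \<Longrightarrow> u x = 1"
  proof (rule Urysohn[of "- U" T 0 "1::real"])
    show "closed (- U)" "closed T" "- U \<inter> T = {}" using T U by auto
  qed auto
  have u01: "0 \<le> u x" "u x \<le> 1" for x using u(2)[of x] by (auto simp: closed_segment_eq_real_ivl)
  have UT: "U - T \<in> lmeasurable" "measure lebesgue (U - T) \<le> 2 * d"
  proof -
    have eq: "U - T = (U - A) \<union> (A - T)" using T U by auto
    show "U - T \<in> lmeasurable" unfolding eq using T U by (intro fmeasurable.Un) auto
    have "measure lebesgue (U - T) \<le> measure lebesgue (U - A) + measure lebesgue (A - T)"
      unfolding eq using T U by (intro measure_Un_le) (auto intro: fmeasurableD)
    also have "\<dots> \<le> d + d"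
      using T(3,4) U(3,4) d by (intro add_mono) (simp_all add: emeasure_eq_measure2 ennreal_less_iff)
    finally show "measure lebesgue (U - T) \<le> 2 * d" by simp
  qed
  have um: "u \<in> borel_measurable lebesgue"
    using u(1) by (intro measurable_completion) (simp add: borel_measurable_continuous_onI)
  have iA: "integrable lebesgue (indicat_real A)"
    using base by (intro integrable_real_indicator) auto
  have iUT: "integrable lebesgue (indicat_real (U - T))"
    using UT by (intro integrable_real_indicator) (auto simp: fmeasurable_def)
  \<comment> \<open>Since \<open>T\<close> lies in \<open>A\<close> and \<open>A\<close> in
    \<open>U\<close>, both functions are 1 on \<open>T\<close> and 0 outside \<open>U\<close>, so
    they can differ only on the thin set \<open>U - T\<close>.\<close>
  have key: "\<bar>indicat_real A x - u x\<bar> \<le> indicat_real (U - T) x" for x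
    using u01[of x] u(3)[of x] u(4)[of x] T U by (auto simp: indicator_def)
  have id: "integrable lebesgue (\<lambda>x. indicat_real A x - u x)"
    by (rule Bochner_Integration.integrable_bound[OF iUT])
       (use um iA key in \<open>auto intro: borel_measurable_diff\<close>)
  have iu: "integrable lebesgue u"
    using Bochner_Integration.integrable_diff[OF iA id] by simp
  have "(LINT z|lebesgue. norm (indicat_real A z *\<^sub>R c - u z *\<^sub>R c)) = (LINT z|lebesgue. \<bar>indicat_real A z - u z\<bar>) * norm c"
    by (simp flip: scaleR_diff_left)
  also have "\<dots> \<le> (LINT z|lebesgue. indicat_real (U - T) z) * norm c"
    by (intro mult_right_mono integral_mono id[THEN integrable_abs] iUT key) auto
  also have "\<dots> \<le> 2 * d * norm c"
    using UT by (intro mult_right_mono) (auto)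
  also have "\<dots> \<le> e"
    using base by (simp add: d_def field_simps add_pos_nonneg)
  finally have "(LINT z|lebesgue. norm (indicat_real A z *\<^sub>R c - u z *\<^sub>R c)) \<le> e" .
  moreover have "continuous_on UNIV (\<lambda>z. u z *\<^sub>R c)" using u by (intro continuous_intros)
  moreover have "integrable lebesgue (\<lambda>z. u z *\<^sub>R c)" using iu by (intro integrable_scaleR_left)
  ultimately show ?case by (auto intro!: exI[of _ "\<lambda>z. u z *\<^sub>R c"])
next
  case (add f1 f2)
  obtain g1 where g1: "continuous_on UNIV g1" "integrable lebesgue g1" "(LINT z|lebesgue. norm (f1 z - g1 z)) \<le> e/2"
    using add.IH(1)[of "e/2"] add.prems by auto
  obtain g2 where g2: "continuous_on UNIV g2" "integrable lebesgue g2" "(LINT z|lebesgue. norm (f2 z - g2 z)) \<le> e/2"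
    using add.IH(2)[of "e/2"] add.prems by auto
  have "(LINT z|lebesgue. norm (f1 z + f2 z - (g1 z + g2 z))) \<le> (LINT z|lebesgue. norm (f1 z - g1 z) + norm (f2 z - g2 z))"
    using add.hyps g1 g2 by (intro integral_mono) (auto simp: norm_diff_triangle_ineq)
  also have "\<dots> = (LINT z|lebesgue. norm (f1 z - g1 z)) + (LINT z|lebesgue. norm (f2 z - g2 z))"
    using add.hyps g1 g2 by (intro Bochner_Integration.integral_add) auto
  also have "\<dots> \<le> e" using g1 g2 by simp
  finally show ?case using g1 g2
    by (intro exI[of _ "\<lambda>z. g1 z + g2 z"]) (auto intro!: continuous_intros)
next
  case (lim f s)
  have "(\<lambda>i. LINT z|lebesgue. norm (s i z - f z)) \<longlonglongrightarrow> (LINT z|lebesgue. norm (f z - f z))"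
  proof (rule integral_dominated_convergence[where w = "\<lambda>z. 3 * norm (f z)"])
    show "AE x in lebesgue. (\<lambda>i. norm (s i x - f x)) \<longlonglongrightarrow> norm (f x - f x)"
      using lim by (intro AE_I2 tendsto_intros) auto
    show "AE x in lebesgue. norm (norm (s i x - f x)) \<le> 3 * norm (f x)" for i
    proof (rule AE_I2)
      fix x show "norm (norm (s i x - f x)) \<le> 3 * norm (f x)"
        using lim(3)[of x i] norm_triangle_ineq4[of "s i x" "f x"] by simp
    qed
  qed (use lim in auto)
  then have "\<forall>\<^sub>F i in sequentially. (LINT z|lebesgue. norm (s i z - f z)) < e/2"
    using lim.prems by (intro order_tendstoD(2)) auto
  then obtain i where i: "(LINT z|lebesgue. norm (s i z - f z)) < e/2"
    by (auto simp: eventually_sequentially)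
  obtain g where g: "continuous_on UNIV g" "integrable lebesgue g" "(LINT z|lebesgue. norm (s i z - g z)) \<le> e/2"
    using lim.IH[of "e/2" i] lim.prems by auto
  have "(LINT z|lebesgue. norm (f z - g z)) \<le> (LINT z|lebesgue. norm (s i z - f z) + norm (s i z - g z))"
  proof (intro integral_mono)
    fix x show "norm (f x - g x) \<le> norm (s i x - f x) + norm (s i x - g x)"
      by (metis dist_norm dist_triangle3)
  qed (use lim.hyps g in auto)
  also have "\<dots> = (LINT z|lebesgue. norm (s i z - f z)) + (LINT z|lebesgue. norm (s i z - g z))"
    using lim.hyps g by (intro Bochner_Integration.integral_add) auto
  also have "\<dots> \<le> e" using i g by simp
  finally show ?case using g by blast
qed

text \<open>The tangent inequality \<open>exp x \<ge> 1 + x\<close> at \<open>x = v - u\<close>. The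
  Lipschitz constant depends on the common upper bound \<open>K\<close>, which is why the exponent
  is truncated in \<open>exp_min_integral_le\<close>.\<close>

lemma exp_lipschitz:
  fixes u v K :: real assumes "u \<le> K" "v \<le> K" shows "exp u \<le> exp v + exp K * \<bar>u - v\<bar>"
proof -
  have "exp u - exp v = exp u * (1 - exp (v - u))" by (simp add: algebra_simps flip: exp_add)
  also have "\<dots> \<le> exp u * (u - v)" using exp_ge_add_one_self[of "v - u"] by (intro mult_left_mono) (linarith, simp)
  also have "\<dots> \<le> exp u * \<bar>u - v\<bar>" by (intro mult_left_mono) auto
  also have "\<dots> \<le> exp K * \<bar>u - v\<bar>" using assms by (intro mult_right_mono) auto
  finally show ?thesis by simp
qed

text \<open>Elements of \<open>'b\<close> are codes of boxes, so that subdivision is a function of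
  the code. The boxes are closed and siblings share faces, hence the partition holds only almost
  everywhere. Halving diameters makes oscillations of continuous functions vanish in the limit,
  while \<open>M\<close> limits how far a mean can jump from a box to its child.\<close>

locale bisection =
  fixes box :: "'b \<Rightarrow> 'a::euclidean_space set" and child :: "'i::finite \<Rightarrow> 'b \<Rightarrow> 'b"
    and adm :: "'b set" and M :: real
  assumes compact_box: "Q \<in> adm \<Longrightarrow> compact (box Q)"
    and measure_box: "Q \<in> adm \<Longrightarrow> measure lebesgue (box Q) > 0"
    and child_adm: "Q \<in> adm \<Longrightarrow> child i Q \<in> adm"
    and child_subset: "Q \<in> adm \<Longrightarrow> box (child i Q) \<subseteq> box Q"
    and diameter_child: "Q \<in> adm \<Longrightarrow> diameter (box (child i Q)) \<le> diameter (box Q) / 2"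
    and measure_child: "Q \<in> adm \<Longrightarrow> measure lebesgue (box Q) \<le> M * measure lebesgue (box (child i Q))"
    and indicator_box: "Q \<in> adm \<Longrightarrow>
      AE z in lebesgue. indicator (box Q) z = (\<Sum>i\<in>UNIV. indicator (box (child i Q)) z :: real)"
begin

abbreviation vol :: "'b \<Rightarrow> real" where
  "vol Q \<equiv> measure lebesgue (box Q)"

abbreviation mean :: "('a \<Rightarrow> 'v::{banach, second_countable_topology}) \<Rightarrow> 'b \<Rightarrow> 'v" where
  "mean f Q \<equiv> average (box Q) f"

text \<open>The centre is free and there is no division by the volume: for a fixed centre this
  quantity is additive over the children, which the oscillation about the mean is not.\<close>

definition osc :: "('a \<Rightarrow> 'v::{banach, second_countable_topology}) \<Rightarrow> 'v \<Rightarrow> 'b \<Rightarrow> real" where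
  "osc f a Q = (LINT z:box Q|lebesgue. norm (f z - a))"

text \<open>
  For \<open>\<phi> Q = vol Q * h (mean f Q)\<close> this is the integral over \<open>box Q\<close> of \<open>h\<close> applied to the \<open>k\<close>-th
  dyadic conditional expectation of \<open>f\<close>, so no measurable functions need to be constructed.
\<close>

fun descend :: "('b \<Rightarrow> real) \<Rightarrow> nat \<Rightarrow> 'b \<Rightarrow> real" where
  "descend \<phi> 0 Q = \<phi> Q"
| "descend \<phi> (Suc k) Q = (\<Sum>i\<in>UNIV. descend \<phi> k (child i Q))"

text \<open>Only boxes of generation \<open>k\<close> below \<open>Q\<close> are ever evaluated, so
  the comparison may assume that they are small. The diameter bound is what
  \<open>descend_osc_tendsto_0\<close> exploits.\<close>

lemma descend_mono:
  assumes "\<And>Q'. Q' \<in> adm \<Longrightarrow> box Q' \<subseteq> box Q \<Longrightarrow> diameter (box Q') \<le> diameter (box Q) / 2 ^ k \<Longrightarrow> \<phi> Q' \<le> \<psi> Q'"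
    and "Q \<in> adm"
  shows "descend \<phi> k Q \<le> descend \<psi> k Q"
  using assms
proof (induction k arbitrary: Q)
  case (Suc k)
  show ?case unfolding descend.simps
  proof (intro sum_mono Suc.IH)
    fix i Q' assume Q': "Q' \<in> adm" "box Q' \<subseteq> box (child i Q)" "diameter (box Q') \<le> diameter (box (child i Q)) / 2 ^ k"
    have "diameter (box (child i Q)) / 2 ^ k \<le> (diameter (box Q) / 2) / 2 ^ k"
      using diameter_child[OF Suc.prems(2)] by (intro divide_right_mono) auto
    then show "\<phi> Q' \<le> \<psi> Q'"
      using Q' Suc.prems child_subset[OF Suc.prems(2)] by (intro Suc.prems(1)) auto
  qed (use Suc.prems child_adm in auto)
qed simp

lemma descend_additive:
  assumes "\<And>Q'. Q' \<in> adm \<Longrightarrow> box Q' \<subseteq> box Q \<Longrightarrow> \<phi> Q' = (\<Sum>i\<in>UNIV. \<phi> (child i Q'))" and "Q \<in> adm"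
  shows "descend \<phi> k Q = \<phi> Q"
  using assms
proof (induction k arbitrary: Q)
  case (Suc k)
  have "descend \<phi> k (child i Q) = \<phi> (child i Q)" for i
    using Suc.prems child_subset[OF Suc.prems(2), of i] child_adm
    by (intro Suc.IH) auto
  then show ?case using Suc.prems by auto
qed simp

lemma descend_linear:
  "descend (\<lambda>Q. c * \<phi> Q + d * \<psi> Q) k Q = c * descend \<phi> k Q + d * descend \<psi> k Q"
  by (induction k arbitrary: Q) (auto simp: sum.distrib sum_distrib_left)

lemma box_lmeasurable: "Q \<in> adm \<Longrightarrow> box Q \<in> lmeasurable"
  using compact_box lmeasurable_compact by blast

lemma box_sets [simp]: "Q \<in> adm \<Longrightarrow> box Q \<in> sets lebesgue"
  using box_lmeasurable by (auto simp: fmeasurable_def)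

lemma set_integrable_sub:
  fixes g :: "'a \<Rightarrow> 'v::{banach, second_countable_topology}"
  shows "set_integrable lebesgue (box R) g \<Longrightarrow> Q \<in> adm \<Longrightarrow> box Q \<subseteq> box R \<Longrightarrow> set_integrable lebesgue (box Q) g"
  by (rule set_integrable_subset) auto

lemma set_integrable_const:
  fixes c :: "'v::{banach, second_countable_topology}"
  shows "Q \<in> adm \<Longrightarrow> set_integrable lebesgue (box Q) (\<lambda>_. c)"
  using box_lmeasurable[of Q] unfolding set_integrable_def
  by (intro integrable_scaleR_left integrable_real_indicator) (auto simp: fmeasurable_def)

lemma integral_const:
  fixes c :: "'v::{banach, second_countable_topology}"
  assumes "Q \<in> adm" shows "(LINT z:box Q|lebesgue. c) = vol Q *\<^sub>R c"
proof -
  have "integrable lebesgue (indicat_real (box Q))"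
    using box_lmeasurable[OF assms] by (intro integrable_real_indicator) (auto simp: fmeasurable_def)
  then show ?thesis
    unfolding set_lebesgue_integral_def by (subst integral_scaleR_left) auto
qed

lemma integral_children:
  fixes g :: "'a \<Rightarrow> 'v::{banach, second_countable_topology}"
  assumes Q: "Q \<in> adm" and g: "set_integrable lebesgue (box Q) g"
  shows "(LINT z:box Q|lebesgue. g z) = (\<Sum>i\<in>UNIV. LINT z:box (child i Q)|lebesgue. g z)"
proof -
  have gi: "integrable lebesgue (\<lambda>z. indicator (box (child i Q)) z *\<^sub>R g z)" for i
    using set_integrable_sub[OF g child_adm[OF Q] child_subset[OF Q]] by (simp add: set_integrable_def)
  have "(LINT z:box Q|lebesgue. g z) = (LINT z|lebesgue. (\<Sum>i\<in>UNIV. indicator (box (child i Q)) z *\<^sub>R g z))"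
    unfolding set_lebesgue_integral_def
  proof (rule integral_cong_AE)
    show "AE z in lebesgue. indicat_real (box Q) z *\<^sub>R g z = (\<Sum>i\<in>UNIV. indicator (box (child i Q)) z *\<^sub>R g z)"
      using indicator_box[OF Q] by eventually_elim (simp add: scaleR_left.sum)
    show "(\<lambda>z. indicat_real (box Q) z *\<^sub>R g z) \<in> borel_measurable lebesgue"
      using g by (simp add: set_integrable_def)
    show "(\<lambda>z. \<Sum>i\<in>UNIV. indicat_real (box (child i Q)) z *\<^sub>R g z) \<in> borel_measurable lebesgue"
      by (intro borel_measurable_sum borel_measurable_integrable gi)
  qed
  also have "\<dots> = (\<Sum>i\<in>UNIV. LINT z:box (child i Q)|lebesgue. g z)"
    unfolding set_lebesgue_integral_def by (intro Bochner_Integration.integral_sum gi)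
  finally show ?thesis .
qed

section \<open>Functions whose mean oscillation over every admissible box is at most B\<close>

context
  fixes f :: "'a \<Rightarrow> 'v::{banach, second_countable_topology}" and B :: real
  assumes f: "\<And>Q. Q \<in> adm \<Longrightarrow> set_integrable lebesgue (box Q) f"
    and osc_le: "\<And>Q. Q \<in> adm \<Longrightarrow> osc f (mean f Q) Q \<le> B * vol Q"
    and B: "B > 0"
begin

lemma set_integrable_norm_diff:
  "Q \<in> adm \<Longrightarrow> set_integrable lebesgue (box Q) (\<lambda>z. norm (f z - a))"
  by (intro set_integrable_norm set_integral_diff f set_integrable_const)

lemma osc_nonneg: "osc f a Q \<ge> 0"
  unfolding osc_def set_lebesgue_integral_def by (intro integral_nonneg_AE) auto

lemma mean_diff: "Q \<in> adm \<Longrightarrow> norm (mean f Q - a) * vol Q \<le> osc f a Q"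
proof -
  assume Q: "Q \<in> adm"
  have "vol Q *\<^sub>R (mean f Q - a) = (LINT z:box Q|lebesgue. f z - a)"
    using measure_box[OF Q]
    by (simp add: average_def scaleR_diff_right set_integral_diff(2)[OF f[OF Q] set_integrable_const[OF Q]] integral_const[OF Q])
  then have "norm (mean f Q - a) * vol Q = norm (LINT z:box Q|lebesgue. f z - a)"
    using measure_box[OF Q] by (metis abs_of_pos mult.commute norm_scaleR)
  also have "\<dots> \<le> osc f a Q"
    unfolding osc_def by (intro set_integral_norm_bound set_integral_diff f set_integrable_const Q)
  finally show ?thesis .
qed

lemma osc_children: "Q \<in> adm \<Longrightarrow> osc f a Q = (\<Sum>i\<in>UNIV. osc f a (child i Q))"
  unfolding osc_def by (intro integral_children set_integrable_norm_diff)

lemma vol_children: "Q \<in> adm \<Longrightarrow> vol Q = (\<Sum>i\<in>UNIV. vol (child i Q))"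
  using integral_children[OF _ set_integrable_const, of Q "1::real"] integral_const[of _ "1::real"] child_adm by simp

text \<open>The oscillation over the child is at most that over the parent, and dividing by the
  volume of the child instead of that of the parent costs the factor \<open>M\<close>.\<close>

lemma mean_child: "Q \<in> adm \<Longrightarrow> norm (mean f (child i Q) - mean f Q) \<le> M * B"
proof -
  assume Q: "Q \<in> adm"
  note C = child_adm[OF Q, of i]
  have "norm (mean f (child i Q) - mean f Q) * vol (child i Q) \<le> osc f (mean f Q) (child i Q)"
    by (rule mean_diff[OF C])
  also have "\<dots> \<le> osc f (mean f Q) Q"
    unfolding osc_children[OF Q] by (rule member_le_sum) (auto simp: osc_nonneg)
  also have "\<dots> \<le> B * vol Q" by (rule osc_le[OF Q])
  also have "\<dots> \<le> B * (M * vol (child i Q))"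
    using B measure_child[OF Q, of i] by (intro mult_left_mono) auto
  finally show ?thesis using measure_box[OF C] by (simp add: mult.assoc [symmetric] mult.commute)
qed

text \<open>The mean is an optimal centre up to a factor 2. This allows any convenient centre, such
  as a value of a continuous approximation.\<close>

lemma osc_mean_le:
  assumes Q: "Q \<in> adm" shows "osc f (mean f Q) Q \<le> 2 * osc f a Q"
proof -
  have "osc f (mean f Q) Q \<le> (LINT z:box Q|lebesgue. norm (f z - a) + norm (mean f Q - a))"
    unfolding osc_def
  proof (rule set_integral_mono)
    fix x show "norm (f x - mean f Q) \<le> norm (f x - a) + norm (mean f Q - a)"
      by (metis dist_norm dist_triangle2)
  qed (intro set_integrable_norm_diff set_integral_add set_integrable_const Q)+
  also have "\<dots> = osc f a Q + vol Q * norm (mean f Q - a)"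
    by (subst set_integral_add(2)) (auto simp: osc_def integral_const Q intro: set_integrable_norm_diff set_integrable_const)
  also have "\<dots> \<le> 2 * osc f a Q" using mean_diff[OF Q, of a] by (simp add: mult.commute)
  finally show ?thesis .
qed

text \<open>When a box is left behind because its mean is too far from the centre, its parent's mean
  was within \<open>4 * B\<close> and the jump adds at most \<open>M * B\<close>. The rate makes the
  exponential of that distance at most 2.\<close>

definition rate :: real where
  "rate = ln 2 / ((4 + M) * B)"

text \<open>The sign of \<open>M\<close> is read off from one box and one child;
  \<open>undefined\<close> serves as an arbitrary child index.\<close>

lemma M_nonneg: "Q \<in> adm \<Longrightarrow> M \<ge> 0"
  using measure_child[of Q undefined] measure_box[of Q] measure_box[OF child_adm, of Q undefined]
  by (metis less_le_trans linorder_not_le mult_neg_pos order_less_imp_le order_less_irrefl)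

lemma rate_pos: "Q \<in> adm \<Longrightarrow> rate > 0"
  using B M_nonneg by (auto simp: rate_def intro!: divide_pos_pos mult_pos_pos add_pos_nonneg)

lemma exp_rate_le_2: "Q \<in> adm \<Longrightarrow> t \<le> (4 + M) * B \<Longrightarrow> exp (rate * t) \<le> 2"
proof -
  assume Q: "Q \<in> adm" and t: "t \<le> (4 + M) * B"
  have "(4 + M) * B > 0" using B M_nonneg[OF Q] by (intro mult_pos_pos) auto
  then have "rate * ((4 + M) * B) = ln 2" using B M_nonneg[OF Q] by (simp add: rate_def)
  then have "rate * t \<le> ln 2" using rate_pos[OF Q] t by (metis mult_left_mono order_less_imp_le)
  then show ?thesis by (metis exp_le_cancel_iff exp_ln zero_less_numeral)
qed

text \<open>
  Instead of stopping at the maximal boxes on which the mean is far from \<open>a\<close>, the induction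
  restarts at such a box with its own mean as new centre; its volume is paid for by \<open>osc f a\<close>.
\<close>

lemma descend_exp_le:
  assumes "Q \<in> adm" "norm (mean f Q - a) \<le> 4 * B"
  shows "descend (\<lambda>Q. vol Q * exp (rate * norm (mean f Q - a))) k Q \<le> 2 * vol Q + 2 / B * osc f a Q"
  using assms
proof (induction k arbitrary: Q a)
  case 0
  have "4 * B \<le> (4 + M) * B" using B M_nonneg[OF 0(1)] by simp
  then have "exp (rate * norm (mean f Q - a)) \<le> 2" using 0 by (intro exp_rate_le_2[OF 0(1)]) linarith
  then have "vol Q * exp (rate * norm (mean f Q - a)) \<le> vol Q * 2" using measure_box[OF 0(1)] by (intro mult_left_mono) auto
  moreover have "0 \<le> 2 / B * osc f a Q" using B osc_nonneg by simp
  ultimately show ?case by simp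
next
  case (Suc k)
  note Q = Suc.prems(1)
  let ?F = "\<lambda>a Q. vol Q * exp (rate * norm (mean f Q - a))"
  have "descend (?F a) k (child i Q) \<le> 2 * vol (child i Q) + 2 / B * osc f a (child i Q)" for i
  proof (cases "norm (mean f (child i Q) - a) \<le> 4 * B")
    case True
    then show ?thesis using Suc.IH child_adm Q by blast
  next
    case False
    define P b where "P = child i Q" and "b = mean f P"
    have P: "P \<in> adm" using child_adm Q by (simp add: P_def)
    have "norm (b - a) \<le> norm (b - mean f Q) + norm (mean f Q - a)"
      by (metis diff_add_cancel add_diff_eq norm_triangle_ineq)
    also have "\<dots> \<le> M * B + 4 * B" using mean_child[OF Q, of i] Suc.prems(2) by (simp add: P_def b_def)
    finally have "norm (b - a) \<le> (4 + M) * B" by (simp add: algebra_simps)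
    then have 2: "exp (rate * norm (b - a)) \<le> 2" by (rule exp_rate_le_2[OF Q])
    \<comment> \<open>The summand with coefficient 0 only brings the bound into the shape of
      \<open>descend_linear\<close>.\<close>
    have "descend (?F a) k P \<le> descend (\<lambda>Q. 2 * ?F b Q + 0 * ?F b Q) k P"
    proof (rule descend_mono[OF _ P])
      fix Q' assume Q': "Q' \<in> adm"
      have "norm (mean f Q' - a) \<le> norm (b - a) + norm (mean f Q' - b)"
        by (metis add.commute diff_add_cancel add_diff_eq norm_triangle_ineq)
      then have "exp (rate * norm (mean f Q' - a)) \<le> exp (rate * norm (b - a)) * exp (rate * norm (mean f Q' - b))"
        using rate_pos[OF Q] by (simp flip: exp_add distrib_left)
      also have "\<dots> \<le> 2 * exp (rate * norm (mean f Q' - b))" using 2 by (intro mult_right_mono) auto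
      finally show "?F a Q' \<le> 2 * ?F b Q' + 0 * ?F b Q'"
        using measure_box[OF Q'] by simp
    qed
    also have "\<dots> = 2 * descend (?F b) k P" unfolding descend_linear by simp
    \<comment> \<open>About its own mean \<open>b\<close> the box \<open>P\<close> has distance 0,
      so the induction hypothesis applies with centre \<open>b\<close>.\<close>
    also have "\<dots> \<le> 2 * (2 * vol P + 2 / B * osc f b P)"
      using B by (intro mult_left_mono Suc.IH P) (auto simp: b_def)
    also have "\<dots> \<le> 2 * (2 * vol P + 2 / B * (B * vol P))"
      using B osc_le[OF P] by (intro mult_left_mono add_left_mono) (auto simp: b_def)
    also have "\<dots> = 8 * vol P" using B by simp
    \<comment> \<open>This is the origin of the threshold \<open>4 * B\<close>: the restart costs
      \<open>8 * vol P\<close>, and a mean further than \<open>4 * B\<close> from \<open>a\<close>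
      forces \<open>osc f a P\<close> to be at least \<open>4 * B * vol P\<close>.\<close>
    also have "\<dots> \<le> 2 / B * osc f a P"
    proof -
      have "4 * B * vol P \<le> norm (b - a) * vol P"
        using False measure_box[OF P] by (intro mult_right_mono) (auto simp: b_def P_def)
      also have "\<dots> \<le> osc f a P" unfolding b_def by (rule mean_diff[OF P])
      finally show ?thesis using B by (simp add: field_simps)
    qed
    finally show ?thesis using measure_box[OF P] by (simp add: P_def)
  qed
  then have "descend (?F a) (Suc k) Q \<le> (\<Sum>i\<in>UNIV. 2 * vol (child i Q) + 2 / B * osc f a (child i Q))"
    unfolding descend.simps by (rule sum_mono)
  \<comment> \<open>Both terms are additive over the children, so the bound does not grow with the
    depth.\<close>
  also have "\<dots> = 2 * vol Q + 2 / B * osc f a Q"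
    by (simp add: vol_children[OF Q] osc_children[OF Q] sum.distrib sum_distrib_left)
  finally show ?case .
qed

text \<open>The substitute for Lebesgue differentiation. On small boxes a continuous
  \<open>g\<close> is nearly constant, so the oscillation of \<open>f\<close> is controlled by the
  integral of \<open>norm (f z - g z)\<close>; this is additive, so its total over a generation is
  the L1 error on \<open>R\<close>, whatever the depth.\<close>

lemma descend_osc_tendsto_0:
  assumes R: "R \<in> adm" and e: "e > 0"
  shows "\<exists>k. descend (\<lambda>Q. osc f (mean f Q) Q) k R \<le> e"
proof -
  let ?f = "\<lambda>z. indicator (box R) z *\<^sub>R f z"
  obtain g where g: "continuous_on UNIV g" "integrable lebesgue g" "(LINT z|lebesgue. norm (?f z - g z)) \<le> e / 4"
    using continuous_L1_approx[of ?f "e / 4"] f[OF R] e by (auto simp: set_integrable_def)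
  \<comment> \<open>The L1 error \<open>e / 4\<close> and the modulus of continuity contribute
    \<open>e / 2\<close> each, after the factor 2 from \<open>osc_mean_le\<close>.\<close>
  define \<eta> where "\<eta> = e / (4 * vol R)"
  have \<eta>: "\<eta> > 0" using e measure_box[OF R] by (simp add: \<eta>_def)
  have "uniformly_continuous_on (box R) g"
    using g(1) compact_box[OF R] by (intro compact_uniformly_continuous) (auto intro: continuous_on_subset)
  then obtain d where d: "d > 0" "\<And>x y. x \<in> box R \<Longrightarrow> y \<in> box R \<Longrightarrow> dist y x < d \<Longrightarrow> dist (g y) (g x) < \<eta>"
    unfolding uniformly_continuous_on_def using \<eta> by metis
  obtain k :: nat where k: "diameter (box R) / d < 2 ^ k"
    using real_arch_pow[of 2 "diameter (box R) / d"] by auto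
  then have k: "diameter (box R) / 2 ^ k < d" using d by (simp add: field_simps)
  have gR: "set_integrable lebesgue (box R) g"
    unfolding set_integrable_def using g(2) R by (intro integrable_mult_indicator) auto
  let ?\<phi> = "\<lambda>Q. LINT z:box Q|lebesgue. norm (f z - g z)"
  have fg: "set_integrable lebesgue (box Q) (\<lambda>z. norm (f z - g z))" if "Q \<in> adm" "box Q \<subseteq> box R" for Q
    using that by (intro set_integrable_norm set_integral_diff f set_integrable_sub[OF gR])
  have "descend (\<lambda>Q. osc f (mean f Q) Q) k R \<le> descend (\<lambda>Q. 2 * ?\<phi> Q + (2 * \<eta>) * vol Q) k R"
  proof (rule descend_mono[OF _ R])
    fix Q assume Q: "Q \<in> adm" "box Q \<subseteq> box R" "diameter (box Q) \<le> diameter (box R) / 2 ^ k"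
    obtain x where x: "x \<in> box Q" using measure_box[OF Q(1)] by fastforce
    have "osc f (g x) Q \<le> (LINT z:box Q|lebesgue. norm (f z - g z) + \<eta>)"
      unfolding osc_def
    proof (rule set_integral_mono)
      fix z assume z: "z \<in> box Q"
      have "dist z x \<le> diameter (box Q)"
        using compact_box[OF Q(1)] x z by (intro diameter_bounded_bound compact_imp_bounded)
      then have "dist (g z) (g x) < \<eta>" using Q x z k by (intro d) auto
      then show "norm (f z - g x) \<le> norm (f z - g z) + \<eta>"
        by (smt (verit) dist_norm dist_triangle)
    qed (intro set_integrable_norm_diff set_integral_add set_integrable_const fg Q)+
    also have "\<dots> = ?\<phi> Q + vol Q * \<eta>"
      using Q by (subst set_integral_add(2)) (auto simp: integral_const intro: fg set_integrable_const)
    finally show "osc f (mean f Q) Q \<le> 2 * ?\<phi> Q + (2 * \<eta>) * vol Q"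
      using osc_mean_le[OF Q(1), of "g x"] by (simp add: algebra_simps)
  qed
  also have "\<dots> = 2 * descend ?\<phi> k R + 2 * \<eta> * descend vol k R" by (rule descend_linear)
  also have "descend ?\<phi> k R = ?\<phi> R" by (rule descend_additive[OF integral_children R]) (auto intro: fg)
  also have "descend vol k R = vol R" by (rule descend_additive[OF vol_children R])
  also have "?\<phi> R \<le> (LINT z|lebesgue. norm (?f z - g z))"
    unfolding set_lebesgue_integral_def
    using fg[OF R] f[OF R] g(2)
    by (intro integral_mono) (auto simp: set_integrable_def indicator_def)
  also have "2 * \<dots> + 2 * \<eta> * vol R \<le> e"
    using g(3) measure_box[OF R] by (simp add: \<eta>_def)
  finally show ?thesis by (auto simp: mult_left_mono)
qed

text \<open>On each small box \<open>f\<close> is replaced by its mean. By the Lipschitz bound the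
  error is a multiple of the total oscillation, which can be made arbitrarily small, and
  \<open>descend_exp_le\<close> bounds the main term at every depth. The constant 4 is 2 plus
  \<open>2 / B * B\<close>, and it does not depend on \<open>N\<close>.\<close>

lemma exp_min_integral_le:
  assumes R: "R \<in> adm" and N: "N \<ge> 0"
  shows "set_integrable lebesgue (box R) (\<lambda>z. exp (rate * min (norm (f z - mean f R)) N))"
    and "(LINT z:box R|lebesgue. exp (rate * min (norm (f z - mean f R)) N)) \<le> 4 * vol R"
proof -
  define a where "a = mean f R"
  let ?e = "\<lambda>w. exp (rate * min (norm (w - a)) N)"
  define L where "L = exp (rate * N) * rate"
  have rate: "rate > 0" by (rule rate_pos[OF R])
  have L: "L \<ge> 0" using rate by (simp add: L_def)
  have Lip: "?e w \<le> ?e w' + L * norm (w - w')" for w w'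
  proof -
    have "?e w \<le> ?e w' + exp (rate * N) * \<bar>rate * min (norm (w - a)) N - rate * min (norm (w' - a)) N\<bar>"
      using rate by (intro exp_lipschitz) auto
    also have "\<bar>rate * min (norm (w - a)) N - rate * min (norm (w' - a)) N\<bar> = rate * \<bar>min (norm (w - a)) N - min (norm (w' - a)) N\<bar>"
      using rate by (simp add: abs_mult flip: right_diff_distrib)
    also have "\<bar>min (norm (w - a)) N - min (norm (w' - a)) N\<bar> \<le> \<bar>norm (w - a) - norm (w' - a)\<bar>" by (auto simp: min_def)
    also have "\<dots> \<le> norm (w - w')" using norm_triangle_ineq3[of "w - a" "w' - a"] by simp
    finally show ?thesis using rate by (simp add: L_def mult_left_mono)
  qed
  have int: "set_integrable lebesgue (box Q) (\<lambda>z. ?e (f z))" if Q: "Q \<in> adm" for Q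
  proof (rule set_integrable_bound[OF set_integrable_const[OF Q, of "exp (rate * N)"]])
    have [measurable]: "(\<lambda>z. indicat_real (box Q) z *\<^sub>R norm (f z - a)) \<in> borel_measurable lebesgue"
      using set_integrable_norm_diff[OF Q, of a] by (auto simp: set_integrable_def)
    have [measurable]: "box Q \<in> sets lebesgue" using Q by simp
    \<comment> \<open>Only the restriction of \<open>f\<close> to the box is known to be measurable,
      so the indicator is repeated inside the exponential.\<close>
    have "(\<lambda>z. indicator (box Q) z * exp (rate * min (indicator (box Q) z *\<^sub>R norm (f z - a)) N)) \<in> borel_measurable lebesgue"
      by measurable
    also have "(\<lambda>z. indicator (box Q) z * exp (rate * min (indicator (box Q) z *\<^sub>R norm (f z - a)) N)) = (\<lambda>z. indicator (box Q) z *\<^sub>R ?e (f z))"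
      by (auto simp: fun_eq_iff indicator_def)
    finally show "set_borel_measurable lebesgue (box Q) (\<lambda>z. ?e (f z))" by (simp add: set_borel_measurable_def)
    show "AE x in lebesgue. x \<in> box Q \<longrightarrow> norm (?e (f x)) \<le> norm (exp (rate * N))"
      using rate by auto
  qed
  show "set_integrable lebesgue (box R) (\<lambda>z. exp (rate * min (norm (f z - mean f R)) N))"
    using int[OF R] by (simp add: a_def)
  let ?I = "\<lambda>Q. LINT z:box Q|lebesgue. ?e (f z)"
  let ?F = "\<lambda>Q. vol Q * exp (rate * norm (mean f Q - a))"
  have "?I R \<le> 4 * vol R + L * e" if e: "e > 0" for e
  proof -
    obtain k where k: "descend (\<lambda>Q. osc f (mean f Q) Q) k R \<le> e" using descend_osc_tendsto_0[OF R e] by auto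
    have "?I R = descend ?I k R"
      by (rule descend_additive[symmetric, OF integral_children R]) (auto intro: int)
    also have "\<dots> \<le> descend (\<lambda>Q. 1 * ?F Q + L * osc f (mean f Q) Q) k R"
    proof (rule descend_mono[OF _ R])
      fix Q assume Q: "Q \<in> adm"
      have "?I Q \<le> (LINT z:box Q|lebesgue. ?e (mean f Q) + L * norm (f z - mean f Q))"
        by (intro set_integral_mono int Q Lip set_integral_add set_integrable_const set_integrable_mult_right set_integrable_norm_diff)
      also have "\<dots> = vol Q * ?e (mean f Q) + L * osc f (mean f Q) Q"
        by (subst set_integral_add(2)) (auto simp: integral_const osc_def Q intro!: set_integrable_const set_integrable_mult_right set_integrable_norm_diff)
      also have "vol Q * ?e (mean f Q) \<le> ?F Q" using rate by (intro mult_left_mono) auto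
      finally show "?I Q \<le> 1 * ?F Q + L * osc f (mean f Q) Q" by simp
    qed
    also have "\<dots> = descend ?F k R + L * descend (\<lambda>Q. osc f (mean f Q) Q) k R" using descend_linear[of 1 ?F L "\<lambda>Q. osc f (mean f Q) Q" k R] by simp
    also have "\<dots> \<le> 4 * vol R + L * e"
    proof (intro add_mono mult_left_mono k L)
      have "descend ?F k R \<le> 2 * vol R + 2 / B * osc f a R" using B R by (intro descend_exp_le) (auto simp: a_def)
      also have "\<dots> \<le> 2 * vol R + 2 / B * (B * vol R)"
        using B osc_le[OF R] unfolding a_def by (intro add_left_mono mult_left_mono) auto
      finally show "descend ?F k R \<le> 4 * vol R" using B by simp
    qed
    finally show ?thesis .
  qed
  note * = this
  \<comment> \<open>The constant \<open>L\<close> depends on \<open>N\<close> but not on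
    \<open>e\<close>, so \<open>e\<close> may be rescaled.\<close>
  have "?I R \<le> 4 * vol R + e" if e: "e > 0" for e
  proof -
    have "L * (e / (L + 1)) \<le> e" using L e by (simp add: field_simps)
    moreover have "e / (L + 1) > 0" using L e by simp
    ultimately show ?thesis using *[of "e / (L + 1)"] by linarith
  qed
  then show "(LINT z:box R|lebesgue. exp (rate * min (norm (f z - mean f R)) N)) \<le> 4 * vol R"
    unfolding a_def by (rule field_le_epsilon)
qed

text \<open>A power is dominated by an exponential: \<open>u powr s\<close> is at most
  \<open>(s / rate) powr s * exp (rate * u)\<close>. Since \<open>1 / rate\<close> is proportional
  to \<open>B\<close>, the bound is homogeneous of degree \<open>s\<close> in \<open>B\<close>,
  which later yields an estimate linear in the bmo norm.\<close>

theorem john_nirenberg_powr: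
  assumes R: "R \<in> adm" and s: "s > 0"
  shows "(\<integral>\<^sup>+z. ennreal (indicator (box R) z * norm (f z - mean f R) powr s) \<partial>lebesgue)
     \<le> ennreal (4 * (s * (4 + M) / ln 2) powr s * B powr s * vol R)"
proof -
  let ?u = "\<lambda>z. indicat_real (box R) z * norm (f z - mean f R)"
  have rate: "rate > 0" by (rule rate_pos[OF R])
  have [measurable]: "box R \<in> sets lebesgue" using R by simp
  have [measurable]: "?u \<in> borel_measurable lebesgue"
    using set_integrable_norm_diff[OF R, of "mean f R"] by (auto simp: set_integrable_def)
  have pw: "min t N powr s \<le> (s / rate) powr s * exp (rate * min t N)" if "t \<ge> 0" "N \<ge> 0" for t N :: real
  proof (cases "min t N = 0")
    case False
    then have m: "min t N > 0" using that by auto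
    \<comment> \<open>Raising \<open>x \<le> exp x\<close> to the power \<open>s\<close> gives the
      comparison; this scaling turns \<open>exp x powr s\<close> into the wanted
      exponential.\<close>
    define x where "x = rate * min t N / s"
    have x: "x > 0" using m rate s by (simp add: x_def)
    have "x \<le> exp x" using exp_ge_add_one_self[of x] by linarith
    then have "x powr s \<le> exp x powr s" using x s by (intro powr_mono2) auto
    also have "\<dots> = exp (rate * min t N)" using s by (simp add: powr_def x_def)
    finally have "(s / rate) powr s * x powr s \<le> (s / rate) powr s * exp (rate * min t N)" by (intro mult_left_mono) auto
    moreover have "(s / rate) powr s * x powr s = min t N powr s"
      using x s rate by (simp add: x_def flip: powr_mult)
    ultimately show ?thesis by simp
  qed auto
  let ?c = "(s / rate) powr s * (4 * vol R)"
  have fin: "(\<integral>\<^sup>+z. ennreal (indicator (box R) z * min (norm (f z - mean f R)) (real N) powr s) \<partial>lebesgue) \<le> ennreal ?c" for N :: nat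
  proof -
    have i: "set_integrable lebesgue (box R) (\<lambda>z. (s / rate) powr s * exp (rate * min (norm (f z - mean f R)) N))"
      by (intro set_integrable_mult_right exp_min_integral_le R) auto
    have "(\<integral>\<^sup>+z. ennreal (indicator (box R) z * min (norm (f z - mean f R)) (real N) powr s) \<partial>lebesgue)
       \<le> (\<integral>\<^sup>+z. ennreal (indicator (box R) z *\<^sub>R ((s / rate) powr s * exp (rate * min (norm (f z - mean f R)) N))) \<partial>lebesgue)"
      using pw by (intro nn_integral_mono ennreal_leI) (auto simp: indicator_def)
    also have "\<dots> = ennreal (LINT z:box R|lebesgue. (s / rate) powr s * exp (rate * min (norm (f z - mean f R)) N))"
      unfolding set_lebesgue_integral_def using i by (intro nn_integral_eq_integral) (auto simp: set_integrable_def)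
    also have "\<dots> = ennreal ((s / rate) powr s * (LINT z:box R|lebesgue. exp (rate * min (norm (f z - mean f R)) N)))"
      by simp
    also have "\<dots> \<le> ennreal ?c"
      by (intro ennreal_leI mult_left_mono exp_min_integral_le R) auto
    finally show ?thesis .
  qed
  \<comment> \<open>Fatou's lemma removes the truncation: for each \<open>z\<close> the truncated
    values are eventually equal to the full one.\<close>
  have "(\<integral>\<^sup>+z. ennreal (indicator (box R) z * norm (f z - mean f R) powr s) \<partial>lebesgue)
    \<le> (\<integral>\<^sup>+z. liminf (\<lambda>N. ennreal (indicator (box R) z * min (norm (f z - mean f R)) (real N) powr s)) \<partial>lebesgue)"
  proof (intro nn_integral_mono Liminf_bounded)
    fix z
    obtain N0 :: nat where "norm (f z - mean f R) \<le> real N0" using real_arch_simple by blast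
    then show "\<forall>\<^sub>F N in sequentially. ennreal (indicator (box R) z * norm (f z - mean f R) powr s)
          \<le> ennreal (indicator (box R) z * min (norm (f z - mean f R)) (real N) powr s)"
      unfolding eventually_sequentially
      by (intro exI[of _ N0]) (auto simp: min_def)
  qed
  also have "\<dots> \<le> liminf (\<lambda>N. \<integral>\<^sup>+z. ennreal (indicator (box R) z * min (norm (f z - mean f R)) (real N) powr s) \<partial>lebesgue)"
  proof (rule nn_integral_liminf)
    fix N :: nat
    have "(\<lambda>z. ennreal (indicator (box R) z * min (?u z) (real N) powr s)) \<in> borel_measurable lebesgue"
      by measurable
    also have "(\<lambda>z. ennreal (indicator (box R) z * min (?u z) (real N) powr s)) =
      (\<lambda>z. ennreal (indicator (box R) z * min (norm (f z - mean f R)) (real N) powr s))"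
      by (auto simp: fun_eq_iff indicator_def)
    finally show "(\<lambda>z. ennreal (indicator (box R) z * min (norm (f z - mean f R)) (real N) powr s)) \<in> borel_measurable lebesgue" .
  qed
  also have "\<dots> \<le> ennreal ?c"
    using fin by (intro Liminf_le) auto
  also have "s / rate = s * (4 + M) / ln 2 * B" by (simp add: rate_def)
  also have "\<dots> powr s = (s * (4 + M) / ln 2) powr s * B powr s"
    using s B M_nonneg[OF R] by (intro powr_mult)
  finally show ?thesis by (simp add: mult_ac)
qed

end
end

section \<open>Rectangles and little bmo\<close>

lemma mem_cube: "z \<in> cube x r \<longleftrightarrow> (\<forall>i. \<bar>z $ i - x $ i\<bar> \<le> r / 2)"
proof -
  have "\<bar>t - u\<bar> \<le> r / 2 \<longleftrightarrow> u - r / 2 \<le> t \<and> t \<le> u + r / 2" for t u :: real by linarith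
  then show ?thesis by (simp only: cube_def mem_box_cart vec_lambda_beta)
qed

lemma cube_nonempty: "r > 0 \<Longrightarrow> cube x r \<noteq> {}"
  using mem_cube[of x x r] by auto

lemma compact_cube: "compact (cube x r)"
  by (simp add: cube_def)

lemma measure_cube:
  fixes x :: "real^'n"
  assumes "r > 0" shows "measure lborel (cube x r) = r ^ CARD('n)"
  using cube_nonempty[OF assms, of x] unfolding cube_def by (subst content_cbox_cart) auto

lemma measure_rectangle:
  fixes x :: "real^'n" and y :: "real^'m"
  assumes "r > 0" "s > 0"
  shows "measure lebesgue (cube x r \<times> cube y s) = r ^ CARD('n) * s ^ CARD('m)"
proof -
  have "measure lborel (cube x r \<times> cube y s) = measure lborel (cube x r) * measure lborel (cube y s)"
    unfolding cube_def by (simp add: content_Pair flip: cbox_Pair_eq)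
  also have "\<dots> = r ^ CARD('n) * s ^ CARD('m)" using assms by (simp add: measure_cube)
  finally show ?thesis by (simp add: cube_def flip: cbox_Pair_eq)
qed

text \<open>A cube is coded by its centre and side length. The sign vector \<sigma> selects the
  upper or lower half in each coordinate, so that all 2^n choices give the dyadic children.\<close>

definition half_cube :: "('n \<Rightarrow> bool) \<Rightarrow> (real^'n) \<times> real \<Rightarrow> (real^'n) \<times> real" where
  "half_cube \<sigma> = (\<lambda>(x, r). (\<chi> i. x $ i + (if \<sigma> i then r / 4 else - r / 4), r / 2))"

lemma half_cube_subset: "(\<lambda>(x, r). cube x r) (half_cube \<sigma> (x, r)) \<subseteq> cube x r"
proof
  fix z assume z: "z \<in> (\<lambda>(x, r). cube x r) (half_cube \<sigma> (x, r))"
  have "\<bar>z $ i - x $ i\<bar> \<le> r / 2" for i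
  proof -
    have "\<bar>z $ i - (x $ i + (if \<sigma> i then r / 4 else - r / 4))\<bar> \<le> r / 2 / 2"
      using z by (simp add: half_cube_def mem_cube)
    then show ?thesis by (cases "\<sigma> i"; simp only: if_True if_False; linarith)
  qed
  then show "z \<in> cube x r" by (simp add: mem_cube)
qed

lemma half_cube_cover: "z \<in> cube x r \<Longrightarrow> \<exists>\<sigma>. z \<in> (\<lambda>(x, r). cube x r) (half_cube \<sigma> (x, r))"
proof -
  assume z: "z \<in> cube x r"
  have "\<bar>z $ i - (x $ i + (if x $ i \<le> z $ i then r / 4 else - r / 4))\<bar> \<le> r / 4" for i
    using z[unfolded mem_cube, rule_format, of i]
    by (cases "x $ i \<le> z $ i"; simp only: if_True if_False; linarith)
  then show ?thesis
    by (intro exI[of _ "\<lambda>i. x $ i \<le> z $ i"]) (simp add: half_cube_def mem_cube)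
qed

definition rectangle :: "((real^'n) \<times> real) \<times> ((real^'m) \<times> real) \<Rightarrow> ((real^'n) \<times> (real^'m)) set" where
  "rectangle = (\<lambda>((x, r), (y, s)). cube x r \<times> cube y s)"

definition half_rectangle where
  "half_rectangle = (\<lambda>(\<sigma>, \<tau>) (P, Q). (half_cube \<sigma> P, half_cube \<tau> Q))"

definition pos_rectangles :: "(((real^'n) \<times> real) \<times> ((real^'m) \<times> real)) set" where
  "pos_rectangles = {(P, Q). snd P > 0 \<and> snd Q > 0}"

text \<open>Written as the norm of the diagonal, the diameter is visibly halved when both side
  lengths are.\<close>

lemma diameter_rectangle:
  fixes x :: "real^'n" and y :: "real^'m"
  assumes "r > 0" "s > 0"
  shows "diameter (cube x r \<times> cube y s) = norm (vec r :: real^'n, vec s :: real^'m)"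
proof -
  let ?l = "(\<chi> i. x $ i - r / 2, \<chi> i. y $ i - s / 2)" and ?u = "(\<chi> i. x $ i + r / 2, \<chi> i. y $ i + s / 2)"
  have "cube x r \<times> cube y s = cbox ?l ?u" by (simp add: cube_def cbox_Pair_eq)
  moreover have "cube x r \<times> cube y s \<noteq> {}"
    using cube_nonempty[OF assms(1), of x] cube_nonempty[OF assms(2), of y] by auto
  ultimately have "diameter (cube x r \<times> cube y s) = dist ?l ?u"
    by (metis diameter_cbox box_ne_empty(1))
  also have "\<dots> = norm (?u - ?l)" by (subst dist_commute) (simp only: dist_norm)
  also have "?u - ?l = (vec r, vec s)" by (simp add: vec_eq_iff)
  finally show ?thesis .
qed

interpretation rect: bisection
  "rectangle :: _ \<Rightarrow> ((real^'n) \<times> (real^'m)) set"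
  "half_rectangle :: ('n::finite \<Rightarrow> bool) \<times> ('m::finite \<Rightarrow> bool) \<Rightarrow> _"
  pos_rectangles "2 ^ CARD('n) * 2 ^ CARD('m)"
proof
  fix Q :: "((real^'n) \<times> real) \<times> ((real^'m) \<times> real)" and i :: "('n::finite \<Rightarrow> bool) \<times> ('m::finite \<Rightarrow> bool)"
  assume Q: "Q \<in> pos_rectangles"
  then obtain x r y s where Q_def: "Q = ((x, r), (y, s))" and rs: "r > 0" "s > 0"
    by (auto simp: pos_rectangles_def)
  obtain \<sigma> \<tau> where i_def: "i = (\<sigma>, \<tau>)" by (cases i)
  have child: "\<exists>x' y'. half_rectangle j Q = ((x', r / 2), (y', s / 2))" for j
    by (auto simp: half_rectangle_def half_cube_def Q_def split: prod.splits)
  show cpt: "compact (rectangle Q)" by (simp add: rectangle_def Q_def compact_Times compact_cube)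
  show "measure lebesgue (rectangle Q) > 0" using rs by (simp add: rectangle_def Q_def measure_rectangle)
  have adm: "half_rectangle j Q \<in> pos_rectangles" for j
    using child[of j] rs by (auto simp: pos_rectangles_def)
  then show "half_rectangle i Q \<in> pos_rectangles" .
  have sub: "rectangle (half_rectangle j Q) \<subseteq> rectangle Q" for j
  proof -
    obtain \<sigma> \<tau> where j: "j = (\<sigma>, \<tau>)" by (cases j)
    show ?thesis using half_cube_subset[of \<sigma> x r] half_cube_subset[of \<tau> y s]
      by (auto simp: rectangle_def half_rectangle_def j Q_def split: prod.splits)
  qed
  then show "rectangle (half_rectangle i Q) \<subseteq> rectangle Q" .
  have meas: "measure lebesgue (rectangle Q) = 2 ^ CARD('n) * 2 ^ CARD('m) * measure lebesgue (rectangle (half_rectangle j Q))" for j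
    using child[of j] rs by (auto simp: rectangle_def Q_def measure_rectangle power_divide)
  then show "measure lebesgue (rectangle Q) \<le> 2 ^ CARD('n) * 2 ^ CARD('m) * measure lebesgue (rectangle (half_rectangle i Q))"
    by (metis order_refl)
  show "diameter (rectangle (half_rectangle i Q)) \<le> diameter (rectangle Q) / 2"
  proof -
    have "(vec (r / 2) :: real^'n, vec (s / 2) :: real^'m) = (1 / 2) *\<^sub>R (vec r, vec s)"
      by (simp add: vec_eq_iff)
    then have "norm (vec (r / 2) :: real^'n, vec (s / 2) :: real^'m) = norm (vec r :: real^'n, vec s :: real^'m) / 2"
      by (metis norm_scaleR abs_of_pos mult.commute mult_1 times_divide_eq_right zero_less_divide_1_iff zero_less_numeral)
    then show ?thesis using child[of i] rs by (auto simp: rectangle_def Q_def diameter_rectangle)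
  qed
  \<comment> \<open>The almost everywhere partition is obtained without examining common faces: the
    children cover the rectangle, so this difference is nonnegative, and their volumes add up, so
    its integral is 0.\<close>
  let ?g = "\<lambda>z. (\<Sum>j\<in>UNIV. indicat_real (rectangle (half_rectangle j Q)) z) - indicat_real (rectangle Q) z"
  have int: "integrable lebesgue (indicat_real (rectangle P))" and
    intv: "(LINT z|lebesgue. indicat_real (rectangle P) z) = measure lebesgue (rectangle P)"
    if "P \<in> pos_rectangles" for P :: "((real^'n) \<times> real) \<times> ((real^'m) \<times> real)"
  proof -
    have "compact (rectangle P)"
      using that by (auto simp: pos_rectangles_def rectangle_def compact_Times compact_cube)
    then have "rectangle P \<in> lmeasurable" by (rule lmeasurable_compact)
    then show "integrable lebesgue (indicat_real (rectangle P))"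
       "(LINT z|lebesgue. indicat_real (rectangle P) z) = measure lebesgue (rectangle P)"
      by (auto intro!: integrable_real_indicator simp: fmeasurable_def)
  qed
  have nonneg: "?g z \<ge> 0" for z
  proof (cases "z \<in> rectangle Q")
    case True
    obtain u v where z: "z = (u, v)" by (cases z)
    have uv: "u \<in> cube x r" "v \<in> cube y s" using True by (auto simp: z rectangle_def Q_def)
    obtain \<sigma> \<tau> where "u \<in> (\<lambda>(x, r). cube x r) (half_cube \<sigma> (x, r))" "v \<in> (\<lambda>(x, r). cube x r) (half_cube \<tau> (y, s))"
      using half_cube_cover[OF uv(1)] half_cube_cover[OF uv(2)] by metis
    then have "z \<in> rectangle (half_rectangle (\<sigma>, \<tau>) Q)"
      by (auto simp: z rectangle_def half_rectangle_def Q_def split: prod.splits)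
    then have "1 \<le> (\<Sum>j\<in>{(\<sigma>, \<tau>)}. indicat_real (rectangle (half_rectangle j Q)) z)" by simp
    also have "\<dots> \<le> (\<Sum>j\<in>UNIV. indicat_real (rectangle (half_rectangle j Q)) z)"
      by (intro sum_mono2) auto
    finally show ?thesis by (simp add: indicator_def)
  qed (simp add: sum_nonneg)
  have gi: "integrable lebesgue ?g"
    by (intro Bochner_Integration.integrable_diff Bochner_Integration.integrable_sum int adm Q)
  have "(LINT z|lebesgue. ?g z) = (\<Sum>j\<in>UNIV. measure lebesgue (rectangle (half_rectangle j Q))) - measure lebesgue (rectangle Q)"
    using int intv adm Q
    by (subst Bochner_Integration.integral_diff) (auto simp: Bochner_Integration.integral_sum intro!: Bochner_Integration.integrable_sum)
  also have "(\<Sum>j\<in>UNIV. measure lebesgue (rectangle (half_rectangle j Q)))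
     = (\<Sum>j\<in>(UNIV :: (('n \<Rightarrow> bool) \<times> ('m \<Rightarrow> bool)) set). measure lebesgue (rectangle Q) / (2 ^ CARD('n) * 2 ^ CARD('m)))"
    by (intro sum.cong refl, subst meas) simp
  also have "\<dots> = measure lebesgue (rectangle Q)"
    by (simp add: card_cartesian_product card_fun flip: UNIV_Times_UNIV)
  finally have "AE z in lebesgue. ?g z = 0"
    using integral_nonneg_eq_0_iff_AE[OF gi] nonneg by simp
  then show "AE z in lebesgue. indicator (rectangle Q) z = (\<Sum>j\<in>UNIV. indicator (rectangle (half_rectangle j Q)) z :: real)"
    by eventually_elim simp
qed

section \<open>From extended-real norms to real integrals\<close>

lemma ennpowr_ennreal: "x \<ge> 0 \<Longrightarrow> ennpowr (ennreal x) a = ennreal (x powr a)"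
  by (simp add: ennpowr_def)

lemma ennpowr_1 [simp]: "ennpowr x 1 = x"
  by (cases x) (auto simp: ennpowr_def)

lemma ennpowr_top [simp]: "ennpowr top a = top"
  by (simp add: ennpowr_def)

lemma ennpowr_mono:
  assumes "a \<ge> 0" "x \<le> y" shows "ennpowr x a \<le> ennpowr y a"
proof (cases y; cases x)
  fix b c :: real assume "y = ennreal b" "0 \<le> b" "x = ennreal c" "0 \<le> c"
  then show ?thesis using assms by (simp add: ennpowr_ennreal powr_mono2)
qed (use assms in \<open>auto simp: top_unique\<close>)

lemma ennpowr_le_ennrealD:
  assumes "ennpowr x (1 / a) \<le> ennreal b" "a > 0" "b \<ge> 0"
  shows "x \<le> ennreal (b powr a)"
proof (cases x)
  case (real t)
  then have "t powr (1 / a) \<le> b" using assms by (simp add: ennpowr_ennreal ennreal_le_iff)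
  then have "(t powr (1 / a)) powr a \<le> b powr a" using assms by (intro powr_mono2) auto
  then show ?thesis using real assms by (simp add: powr_powr ennreal_leI)
next
  case top then show ?thesis using assms by (simp add: top_unique)
qed

lemma Lp_norm_cut:
  "Lp_norm p (cut A f) = ennpowr (\<integral>\<^sup>+z. ennreal (indicator A z * norm (f z) powr p) \<partial>lebesgue) (1 / p)"
proof -
  have "norm (cut A f z) powr p = indicator A z * norm (f z) powr p" for z
    by (cases "z \<in> A") (auto simp: cut_def)
  then show ?thesis by (simp add: Lp_norm_def)
qed

lemma Lp_norm_1_cut:
  fixes f :: "'a::euclidean_space \<Rightarrow> 'v::{banach, second_countable_topology}"
  assumes "set_integrable lebesgue A f"
  shows "Lp_norm 1 (cut A f) = ennreal (LINT z:A|lebesgue. norm (f z))"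
proof -
  have "(\<integral>\<^sup>+z. ennreal (indicator A z * norm (f z)) \<partial>lebesgue) = ennreal (LINT z:A|lebesgue. norm (f z))"
    unfolding set_lebesgue_integral_def using set_integrable_norm[OF assms]
    by (subst nn_integral_eq_integral) (auto simp: set_integrable_def)
  then show ?thesis by (simp add: Lp_norm_cut)
qed

lemma Lp_norm_1_indicator:
  assumes "A \<in> lmeasurable"
  shows "Lp_norm 1 (indicator A :: _ \<Rightarrow> real) = ennreal (measure lebesgue A)"
proof -
  have "(\<integral>\<^sup>+z. ennreal (indicator A z) \<partial>lebesgue) = ennreal (measure lebesgue A)"
    using assms by (subst nn_integral_eq_integral)
      (auto intro!: integrable_real_indicator simp: fmeasurable_def simp del: emeasure_completion)
  moreover have "norm (indicat_real A z) powr 1 = indicat_real A z" for z by (simp add: indicator_def)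
  ultimately show ?thesis by (simp add: Lp_norm_def)
qed

lemma set_integrable_minus_average:
  fixes f :: "(real^'n) \<times> (real^'m) \<Rightarrow> complex"
  assumes "locally_integrable f" "R \<in> rectangles"
  shows "set_integrable lebesgue R (\<lambda>z. f z - average R f)"
proof -
  obtain x r y s where R: "R = cube x r \<times> cube y s"
    using assms(2) unfolding rectangles_def by blast
  have cpt: "compact R" by (simp add: R compact_Times compact_cube)
  then have "R \<in> lmeasurable" by (rule lmeasurable_compact)
  then have "integrable lebesgue (indicat_real R)"
    by (intro integrable_real_indicator) (auto simp: fmeasurable_def)
  then have "set_integrable lebesgue R (\<lambda>z. average R f)"
    unfolding set_integrable_def by (rule integrable_scaleR_left)
  then show ?thesis using assms cpt by (intro set_integral_diff) (auto simp: locally_integrable_def)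
qed

text \<open>Rectangles have positive finite measure, so the quotient can be cleared. The right-hand
  side is the oscillation hypothesis of the bisection argument.\<close>

lemma bmo_norm_le_iff:
  fixes f :: "(real^'n::finite) \<times> (real^'m::finite) \<Rightarrow> complex"
  assumes f: "locally_integrable f" and b: "b \<ge> 0"
  shows "bmo_norm f \<le> ennreal b \<longleftrightarrow>
    (\<forall>R\<in>rectangles. (LINT z:R|lebesgue. norm (f z - average R f)) \<le> b * measure lebesgue R)"
proof -
  have "Lp_norm 1 (cut R (\<lambda>z. f z - average R f)) / Lp_norm 1 (indicator R :: _ \<Rightarrow> real) \<le> ennreal b \<longleftrightarrow>
     (LINT z:R|lebesgue. norm (f z - average R f)) \<le> b * measure lebesgue R" if R_in: "R \<in> rectangles" for R
  proof -
    obtain x r y s where R: "R = cube x r \<times> cube y s" "r > 0" "s > 0"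
      using R_in unfolding rectangles_def by blast
    have pos: "measure lebesgue R > 0" using R by (simp add: measure_rectangle)
    have cpt: "compact R" by (simp add: R compact_Times compact_cube)
    then have "R \<in> lmeasurable" by (rule lmeasurable_compact)
    have "set_integrable lebesgue R (\<lambda>z. f z - average R f)"
      by (rule set_integrable_minus_average[OF f R_in])
    moreover have "0 \<le> (LINT z:R|lebesgue. norm (f z - average R f))"
      unfolding set_lebesgue_integral_def by (intro integral_nonneg_AE) auto
    ultimately show ?thesis using pos b \<open>R \<in> lmeasurable\<close>
      by (simp add: Lp_norm_1_cut Lp_norm_1_indicator divide_ennreal ennreal_le_iff pos_divide_le_eq)
  qed
  then show ?thesis by (auto simp: bmo_norm_def SUP_le_iff)
qed

lemma bmo_integral_powr_le:
  fixes f :: "(real^'n::finite) \<times> (real^'m::finite) \<Rightarrow> complex"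
  assumes f: "locally_integrable f" "bmo_norm f \<le> ennreal b" and b: "b > 0"
    and R: "R \<in> rectangles" and s: "s > 0"
  shows "(\<integral>\<^sup>+z. ennreal (indicator R z * norm (f z - average R f) powr s) \<partial>lebesgue)
     \<le> ennreal (4 * (s * (4 + 2 ^ CARD('n) * 2 ^ CARD('m)) / ln 2) powr s * b powr s * measure lebesgue R)"
proof -
  have rect: "rectangle Q \<in> rectangles" if "Q \<in> pos_rectangles" for Q :: "((real^'n) \<times> real) \<times> ((real^'m) \<times> real)"
  proof -
    obtain x r y t where "Q = ((x, r), (y, t))" by (metis prod.exhaust)
    then show ?thesis using that unfolding rectangles_def by (auto simp: pos_rectangles_def rectangle_def)
  qed
  obtain x r y t where xy: "R = cube x r \<times> cube y t" "r > 0" "t > 0"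
    using R unfolding rectangles_def by blast
  define Q where "Q = ((x, r), (y, t))"
  have Q: "R = rectangle Q" "Q \<in> pos_rectangles"
    using xy by (simp_all add: Q_def pos_rectangles_def rectangle_def)
  show ?thesis unfolding Q(1)
  proof (rule rect.john_nirenberg_powr)
    show "set_integrable lebesgue (rectangle P) f" if "P \<in> pos_rectangles" for P
      using f(1) rect.compact_box[OF that] by (simp add: locally_integrable_def)
    show "rect.osc f (average (rectangle P) f) P \<le> b * measure lebesgue (rectangle P)" if "P \<in> pos_rectangles" for P
      using f bmo_norm_le_iff[OF f(1), of b] b rect[OF that] by (simp add: rect.osc_def)
  qed (use b Q s in auto)
qed

section \<open>Cubes and dyadic shells\<close>

lemma mem_dyadic_cube: "z \<in> dyadic_cube k \<longleftrightarrow> (\<forall>i. \<bar>z $ i\<bar> \<le> 2 powi k / 2)"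
  by (simp add: dyadic_cube_def mem_cube)

lemma dyadic_cube_mono: "k \<le> l \<Longrightarrow> dyadic_cube k \<subseteq> dyadic_cube l"
proof
  fix z assume "k \<le> l" "z \<in> dyadic_cube k"
  moreover have "(2::real) powi k \<le> 2 powi l" using \<open>k \<le> l\<close> by (intro power_int_increasing) auto
  ultimately show "z \<in> dyadic_cube l" unfolding mem_dyadic_cube by (meson divide_right_mono order_trans zero_le_numeral)
qed

lemma borel_cube [measurable]: "cube x r \<in> sets borel"
  by (simp add: cube_def)

lemma borel_dyadic_cube [measurable]: "dyadic_cube k \<in> sets borel"
  by (simp add: dyadic_cube_def borel_cube)

lemma borel_dyadic_shell [measurable]: "dyadic_shell k \<in> sets borel"
  by (simp add: dyadic_shell_def borel_dyadic_cube)

lemma cube_shell_fmeasurable: "cube x r \<inter> dyadic_shell i \<in> fmeasurable lborel"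
proof -
  have "cube x r \<in> fmeasurable lborel" by (simp add: cube_def)
  then show ?thesis by (rule fmeasurableI2) (auto simp: borel_cube borel_dyadic_shell)
qed

text \<open>The dyadic cube of scale \<open>K\<close> is the ball of radius
  \<open>2 powi K / 2\<close> in the maximum norm, so a point of maximum norm \<open>h\<close> lies
  in the shell of scale \<open>K\<close>.\<close>

lemma exists_dyadic_scale:
  fixes h :: real assumes "h > 0"
  shows "\<exists>K::int. 2 powi K / 4 < h \<and> h \<le> 2 powi K / 2"
proof -
  define K where "K = \<lceil>log 2 h\<rceil> + 1"
  have pw: "2 powi K = 2 powr real_of_int K" by (simp add: powr_real_of_int')
  have "log 2 h \<le> real_of_int K - 1" "real_of_int K - 2 < log 2 h" unfolding K_def by linarith+
  then have "h \<le> 2 powr (real_of_int K - 1)" "2 powr (real_of_int K - 2) < h"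
    using assms by (simp_all add: log_le_iff less_log_iff)
  then show ?thesis by (intro exI[of _ K]) (simp add: pw powr_diff)
qed

lemma cube_shell_geometry:
  fixes x :: "real^'n" and r :: real
  assumes r: "r > 0"
  obtains K :: int where
    "\<And>i. i > K \<Longrightarrow> cube x r \<inter> dyadic_shell i = {}"
    "\<And>i. i \<le> K \<Longrightarrow> measure lborel (cube x r \<inter> dyadic_shell i) \<le> (8 * 2 powi (i - K) * r) ^ CARD('n)"
    "\<exists>i\<in>{K - 1, K}. r ^ CARD('n) / 32 \<le> measure lborel (cube x r \<inter> dyadic_shell i)"
proof -
  \<comment> \<open>The largest maximum norm attained on the cube, reached in coordinate
    \<open>j\<close> on its outer face; \<open>K\<close> is then the least scale whose dyadic cube
    contains the cube.\<close>
  define h where "h = Max (range (\<lambda>i. \<bar>x $ i\<bar> + r / 2))"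
  have h_ge: "\<bar>x $ i\<bar> + r / 2 \<le> h" for i unfolding h_def by (intro Max_ge) auto
  have "h \<in> range (\<lambda>i. \<bar>x $ i\<bar> + r / 2)" unfolding h_def by (intro Max_in) auto
  then obtain j where j: "\<bar>x $ j\<bar> + r / 2 = h" by blast
  have "h > 0" using j r by linarith
  then obtain K :: int where K: "2 powi K / 4 < h" "h \<le> 2 powi K / 2" using exists_dyadic_scale by blast
  define t :: real where "t = 2 powi K"
  have t: "t / 4 < h" "h \<le> t / 2" "t > 0" using K by (auto simp: t_def)
  have rt: "r \<le> t" using j t by linarith
  have powi: "2 powi i = 2 powi (i - K) * t" for i
    by (simp add: t_def flip: power_int_add)
  have in_K: "cube x r \<subseteq> dyadic_cube K"
  proof
    fix z assume z: "z \<in> cube x r"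
    have "\<bar>z $ i\<bar> \<le> t / 2" for i
      using z[unfolded mem_cube, rule_format, of i] h_ge[of i] t by linarith
    then show "z \<in> dyadic_cube K" by (simp add: mem_dyadic_cube t_def)
  qed
  show thesis
  proof (rule that[of K])
    fix i assume "i > K"
    then have "dyadic_cube K \<subseteq> dyadic_cube (i - 1)" by (intro dyadic_cube_mono) auto
    then show "cube x r \<inter> dyadic_shell i = {}" using in_K by (auto simp: dyadic_shell_def)
  next
    fix i assume i: "i \<le> K"
    let ?S = "cube x r \<inter> dyadic_shell i"
    have le_r: "measure lborel ?S \<le> r ^ CARD('n)"
      unfolding measure_cube[OF r, of x, symmetric]
      by (intro measure_mono_fmeasurable) (auto simp: cube_def borel_dyadic_shell)
    have le_i: "measure lborel ?S \<le> (2 powi i) ^ CARD('n)"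
    proof -
      have "measure lborel ?S \<le> measure lborel (dyadic_cube i :: (real^'n) set)"
        by (intro measure_mono_fmeasurable)
          (auto simp: cube_def dyadic_cube_def dyadic_shell_def)
      also have "\<dots> = (2 powi i) ^ CARD('n)" unfolding dyadic_cube_def by (rule measure_cube) simp
      finally show ?thesis .
    qed
    \<comment> \<open>Three reasons for the same bound. For a large side, the measure of the dyadic
      cube of scale \<open>i\<close> suffices. For a small side and \<open>i\<close> near
      \<open>K\<close>, the factor \<open>8 * 2 powi (i - K)\<close> is at least 1 and the volume of
      the cube suffices. For a small side and smaller \<open>i\<close>, the \<open>j\<close>-th
      coordinate keeps the cube away from the shell.\<close>
    consider "t / 8 \<le> r" | "r < t / 8" "i \<ge> K - 3" | "r < t / 8" "i < K - 3" by linarith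
    then show "measure lborel ?S \<le> (8 * 2 powi (i - K) * r) ^ CARD('n)"
    proof cases
      case 1
      have "2 powi i \<le> 8 * 2 powi (i - K) * r"
        unfolding powi[of i] using 1 mult_left_mono[of "t / 8" r "8 * 2 powi (i - K)"] by simp
      then have "(2 powi i) ^ CARD('n) \<le> (8 * 2 powi (i - K) * r) ^ CARD('n)" by (intro power_mono) auto
      then show ?thesis using le_i by linarith
    next
      case 2
      have "(2::real) powi (-3) \<le> 2 powi (i - K)" using 2 by (intro power_int_increasing) auto
      then have "1 \<le> 8 * (2::real) powi (i - K)" by (simp add: power_int_minus)
      then have "r \<le> 8 * 2 powi (i - K) * r" using mult_right_mono[of 1 _ r] r by simp
      then have "r ^ CARD('n) \<le> (8 * 2 powi (i - K) * r) ^ CARD('n)" using r by (intro power_mono) auto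
      then show ?thesis using le_r by linarith
    next
      case 3
      have "(2::real) powi (i - K) \<le> 2 powi (-3)" using 3 by (intro power_int_increasing) auto
      then have "(2::real) powi i \<le> t / 8" unfolding powi[of i] using t by (simp add: power_int_minus)
      have "?S = {}"
      proof (rule equals0I)
        fix z assume z: "z \<in> ?S"
        then have "\<bar>z $ j\<bar> \<le> 2 powi i / 2" by (auto simp: dyadic_shell_def mem_dyadic_cube)
        moreover have "\<bar>z $ j - x $ j\<bar> \<le> r / 2" using z by (auto simp: mem_cube)
        ultimately show False using j t 3 \<open>2 powi i \<le> t / 8\<close> by linarith
      qed
      then show ?thesis using r by simp
    qed
  next
    \<comment> \<open>\<open>D\<close> is the slab of thickness \<open>r / 16\<close> at the face of
      the cube furthest from the origin in direction \<open>j\<close>. There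
      \<open>\<bar>z $ j\<bar>\<close> is at least \<open>h - r / 16\<close>, which exceeds
      \<open>t / 8\<close> because \<open>h > t / 4\<close> and \<open>r \<le> t\<close>. So
      \<open>D\<close> lies in two shells, and one of them receives half of its measure.\<close>
    define p where "p = (if x $ j \<ge> 0 then x $ j + r / 2 - r / 16 else x $ j - r / 2)"
    define D where "D = cbox (\<chi> i. if i = j then p else x $ i - r / 2) (\<chi> i. if i = j then p + r / 16 else x $ i + r / 2)"
    have mem_D: "z \<in> D \<longleftrightarrow> (\<forall>i. (if i = j then p else x $ i - r / 2) \<le> z $ i \<and> z $ i \<le> (if i = j then p + r / 16 else x $ i + r / 2))" for z
      by (simp add: D_def mem_box_cart)
    have "measure lborel D = (\<Prod>i\<in>UNIV. if i = j then r / 16 else r)"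
    proof -
      have "(\<chi> i. if i = j then p else x $ i - r / 2) \<in> D" using r by (auto simp: mem_D)
      then show ?thesis unfolding D_def by (subst content_cbox_cart) (auto intro!: prod.cong)
    qed
    also have "\<dots> = r ^ CARD('n) / 16"
    proof -
      have "(\<Prod>i\<in>UNIV. if i = j then r / 16 else r) = (r / 16) * (\<Prod>i\<in>UNIV - {j}. r)"
        by (subst prod.remove[of _ j]) (auto intro!: prod.cong)
      also have "\<dots> = r ^ CARD('n) / 16"
        by (simp add: card_Diff_singleton power_minus_mult flip: power_Suc)
      finally show ?thesis .
    qed
    finally have D: "measure lborel D = r ^ CARD('n) / 16" .
    let ?S = "\<lambda>i. cube x r \<inter> dyadic_shell i"
    have "D \<subseteq> ?S (K - 1) \<union> ?S K"
    proof
      fix z assume z: "z \<in> D"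
      have zj: "p \<le> z $ j" "z $ j \<le> p + r / 16" using z[unfolded mem_D, rule_format, of j] by simp_all
      have "\<bar>z $ i - x $ i\<bar> \<le> r / 2" for i
      proof (cases "i = j")
        case True then show ?thesis using zj r unfolding p_def by (cases "x $ j \<ge> 0"; simp only: if_True if_False; linarith)
      next
        case False
        then have "x $ i - r / 2 \<le> z $ i" "z $ i \<le> x $ i + r / 2" using z[unfolded mem_D, rule_format, of i] by simp_all
        then show ?thesis by linarith
      qed
      then have zx: "z \<in> cube x r" by (simp add: mem_cube)
      have "\<bar>z $ j\<bar> > t / 8"
        using zj r j t rt unfolding p_def by (cases "x $ j \<ge> 0"; simp only: if_True if_False; linarith)
      moreover have "2 powi (K - 2) / 2 = t / 8" by (simp add: t_def power_int_diff)
      ultimately have "z \<notin> dyadic_cube (K - 2)" unfolding mem_dyadic_cube by (metis linorder_not_less)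
      then show "z \<in> ?S (K - 1) \<union> ?S K"
        using zx in_K by (auto simp: dyadic_shell_def)
    qed
    then have "measure lborel D \<le> measure lborel (?S (K - 1) \<union> ?S K)"
      by (intro measure_mono_fmeasurable fmeasurable.Un cube_shell_fmeasurable) (auto simp: D_def)
    also have "\<dots> \<le> measure lborel (?S (K - 1)) + measure lborel (?S K)"
      by (intro measure_Un_le) (auto simp: borel_cube borel_dyadic_shell)
    finally show "\<exists>i\<in>{K - 1, K}. r ^ CARD('n) / 32 \<le> measure lborel (?S i)"
      unfolding D by (rule_tac ccontr) (simp; linarith)
  qed
qed

section \<open>Product measure, Hoelder's inequality and geometric sums\<close>

lemma emeasure_lebesgue_Times:
  fixes A :: "'a::euclidean_space set" and B :: "'b::euclidean_space set"
  assumes "A \<in> sets borel" "B \<in> sets borel"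
  shows "emeasure lebesgue (A \<times> B) = emeasure lborel A * emeasure lborel B"
proof -
  have "A \<times> B \<in> sets lborel" using assms by (simp add: borel_Times)
  then have "emeasure lebesgue (A \<times> B) = emeasure lborel (A \<times> B)" by simp
  also have "\<dots> = emeasure (lborel \<Otimes>\<^sub>M lborel) (A \<times> B)" by (simp only: lborel_prod)
  also have "\<dots> = emeasure lborel A * emeasure lborel B"
    using assms by (intro lborel.emeasure_pair_measure_Times) auto
  finally show ?thesis .
qed

text \<open>Above the level \<open>M\<close> the factor \<open>u powr (1 - s)\<close> is at most
  \<open>M powr (1 - s)\<close>. The level stays free for later optimisation.\<close>

lemma le_add_powr:
  fixes u M s :: real
  assumes "u \<ge> 0" "M > 0" "s \<ge> 1"
  shows "u \<le> M + M powr (1 - s) * u powr s"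
proof (cases "u \<le> M")
  case False
  then have "u > 0" using assms by linarith
  then have "u = u powr (1 - s) * u powr s" by (simp flip: powr_add)
  also have "\<dots> \<le> M powr (1 - s) * u powr s"
    using False assms by (intro mult_right_mono powr_mono2') auto
  finally show ?thesis using assms by linarith
qed (auto intro: add_increasing2)

text \<open>Hoelder's inequality up to a factor of 2, by integrating the pointwise bound \<open>le_add_powr\<close> with \<open>M = (X / Y) powr (1 / s)\<close>.\<close>

lemma nn_integral_powr_le:
  fixes h :: "'a::euclidean_space \<Rightarrow> real"
  assumes A: "A \<in> sets lebesgue" "emeasure lebesgue A \<le> ennreal Y" and XY: "X > 0" "Y > 0" and s: "s \<ge> 1"
    and h: "\<And>z. h z \<ge> 0" "(\<lambda>z. indicator A z * h z) \<in> borel_measurable lebesgue"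
    and X: "(\<integral>\<^sup>+z. ennreal (indicator A z * h z powr s) \<partial>lebesgue) \<le> ennreal X"
  shows "(\<integral>\<^sup>+z. ennreal (indicator A z * h z) \<partial>lebesgue) \<le> ennreal (2 * X powr (1 / s) * Y powr (1 - 1 / s))"
proof -
  define M where "M = (X / Y) powr (1 / s)"
  have M: "M > 0" using XY by (simp add: M_def)
  have ind: "indicat_real A z * h z powr s = (indicator A z * h z) powr s" for z
    by (simp add: indicator_def)
  have meas: "(\<lambda>z. ennreal (indicat_real A z * h z powr s)) \<in> borel_measurable lebesgue"
    unfolding ind using h(2) by measurable
  have "(\<integral>\<^sup>+z. ennreal (indicator A z * h z) \<partial>lebesgue)
     \<le> (\<integral>\<^sup>+z. ennreal M * indicator A z + ennreal (M powr (1 - s)) * ennreal (indicator A z * h z powr s) \<partial>lebesgue)"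
  proof (intro nn_integral_mono)
    fix z
    show "ennreal (indicator A z * h z) \<le> ennreal M * indicator A z + ennreal (M powr (1 - s)) * ennreal (indicator A z * h z powr s)"
    proof (cases "z \<in> A")
      case True
      have "ennreal (h z) \<le> ennreal (M + M powr (1 - s) * h z powr s)"
        using h(1) M s by (intro ennreal_leI le_add_powr)
      then show ?thesis using True M by (simp add: ennreal_mult)
    qed simp
  qed
  also have "\<dots> = ennreal M * emeasure lebesgue A + ennreal (M powr (1 - s)) * (\<integral>\<^sup>+z. ennreal (indicator A z * h z powr s) \<partial>lebesgue)"
    using A meas by (subst nn_integral_add) (auto simp: nn_integral_cmult nn_integral_cmult_indicator simp del: emeasure_completion)
  also have "\<dots> \<le> ennreal M * ennreal Y + ennreal (M powr (1 - s)) * ennreal X"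
    by (intro add_mono mult_left_mono A X) auto
  also have "\<dots> = ennreal (M * Y + M powr (1 - s) * X)"
    using M XY by (subst ennreal_plus) (auto simp: ennreal_mult)
  \<comment> \<open>The chosen level balances the two terms: each equals
    \<open>X powr (1 / s) * Y powr (1 - 1 / s)\<close>.\<close>
  also have "M * Y + M powr (1 - s) * X = 2 * X powr (1 / s) * Y powr (1 - 1 / s)"
  proof -
    have "M * Y = X powr (1 / s) * (Y powr 1 / Y powr (1 / s))"
      using XY by (simp add: M_def powr_divide)
    then have 1: "M * Y = X powr (1 / s) * Y powr (1 - 1 / s)"
      by (simp only: powr_diff)
    have "M powr (1 - s) = (X / Y) powr (1 / s - 1)"
      using s by (simp add: M_def powr_powr diff_divide_distrib)
    also have "\<dots> = X powr (1 / s) / X * (Y / Y powr (1 / s))"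
      using XY by (simp add: powr_divide powr_diff)
    finally have "M powr (1 - s) * X = X powr (1 / s) * (Y powr 1 / Y powr (1 / s))"
      using XY by simp
    then have 2: "M powr (1 - s) * X = X powr (1 / s) * Y powr (1 - 1 / s)"
      by (simp only: powr_diff)
    show ?thesis using 1 2 by simp
  qed
  finally show ?thesis .
qed

lemma cut_cut: "cut A (cut B f) = cut (A \<inter> B) f"
  by (auto simp: cut_def fun_eq_iff indicator_def)

lemma Lp_norm_cut_empty: "Lp_norm p (cut {} f) = 0"
  by (simp add: Lp_norm_cut ennpowr_def)

lemma Lp_norm_cut_mono:
  assumes "A \<subseteq> B" "p > 0" shows "Lp_norm p (cut A f) \<le> Lp_norm p (cut B f)"
  unfolding Lp_norm_cut using assms
  by (intro ennpowr_mono nn_integral_mono ennreal_leI) (auto simp: indicator_def)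

lemma dyadic_shell_outside: "i > L \<Longrightarrow> dyadic_shell i \<inter> dyadic_cube L = {}"
  using dyadic_cube_mono[of L "i - 1"] by (auto simp: dyadic_shell_def)

lemma dyadic_shell_inside: "i \<le> L \<Longrightarrow> dyadic_shell i \<subseteq> dyadic_cube L"
  using dyadic_cube_mono[of i L] by (auto simp: dyadic_shell_def)

text \<open>The sum over n \<ge> 0 of 2^(-n \<rho>), with n counting shells downward from the top
  scale.\<close>

definition geo :: "real \<Rightarrow> real" where
  "geo \<rho> = 1 / (1 - 2 powr (- \<rho>))"

lemma geo_pos: "\<rho> > 0 \<Longrightarrow> geo \<rho> > 0"
  by (simp add: geo_def powr_less_one)

text \<open>Stated for finite sets, because nonnegative infinite sums are handled below through
  their finite partial sums. The substitution n = K - i turns it into a partial geometric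
  series.\<close>

lemma sum_powr_le_geo:
  fixes K :: int
  assumes F: "finite F" "\<And>i. i \<in> F \<Longrightarrow> i \<le> K" and \<rho>: "\<rho> > 0"
  shows "(\<Sum>i\<in>F. 2 powr (\<rho> * real_of_int (i - K))) \<le> geo \<rho>"
proof -
  let ?x = "2 powr (- \<rho>)"
  have x: "0 < ?x" "?x < 1" using \<rho> by (auto simp: powr_less_one)
  have inj: "inj_on (\<lambda>i. nat (K - i)) F"
  proof (rule inj_onI)
    fix i j assume "i \<in> F" "j \<in> F" "nat (K - i) = nat (K - j)"
    then show "i = j" using F(2)[of i] F(2)[of j] by arith
  qed
  have "2 powr (\<rho> * real_of_int (i - K)) = ?x ^ nat (K - i)" if "i \<in> F" for i
    using F(2)[OF that] x by (simp flip: powr_realpow add: powr_powr algebra_simps)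
  then have "(\<Sum>i\<in>F. 2 powr (\<rho> * real_of_int (i - K))) = (\<Sum>n\<in>(\<lambda>i. nat (K - i)) ` F. ?x ^ n)"
    by (simp add: sum.reindex[OF inj])
  also have "\<dots> \<le> (\<Sum>n. ?x ^ n)" using F x by (intro sum_le_suminf summable_geometric) auto
  also have "\<dots> = geo \<rho>" using x by (simp add: suminf_geometric geo_def)
  finally show ?thesis .
qed

text \<open>Enlarging \<open>F\<close> to the product of its projections only adds nonnegative
  terms, and there the sum factorises.\<close>

lemma sum_pair_powr_le_geo:
  fixes K1 K2 :: int
  assumes F: "finite F" "\<And>i j. (i, j) \<in> F \<Longrightarrow> i \<le> K1 \<and> j \<le> K2" and \<rho>: "\<rho>1 > 0" "\<rho>2 > 0"
  shows "(\<Sum>(i, j)\<in>F. 2 powr (\<rho>1 * real_of_int (i - K1)) * 2 powr (\<rho>2 * real_of_int (j - K2))) \<le> geo \<rho>1 * geo \<rho>2"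
proof -
  have "(\<Sum>(i, j)\<in>F. 2 powr (\<rho>1 * real_of_int (i - K1)) * 2 powr (\<rho>2 * real_of_int (j - K2)))
     \<le> (\<Sum>(i, j)\<in>fst ` F \<times> snd ` F. 2 powr (\<rho>1 * real_of_int (i - K1)) * 2 powr (\<rho>2 * real_of_int (j - K2)))"
    using F by (intro sum_mono2) (auto simp: subset_fst_snd intro!: finite_cartesian_product)
  also have "\<dots> = (\<Sum>i\<in>fst ` F. 2 powr (\<rho>1 * real_of_int (i - K1))) * (\<Sum>j\<in>snd ` F. 2 powr (\<rho>2 * real_of_int (j - K2)))"
    by (simp add: sum_product sum.cartesian_product)
  also have "\<dots> \<le> geo \<rho>1 * geo \<rho>2"
    using F \<rho> geo_pos[of \<rho>1] by (intro mult_mono sum_powr_le_geo sum_nonneg) auto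
  finally show ?thesis .
qed

section \<open>Estimates for the Morrey-Herz norm\<close>

lemma ennpowr_mult_powr:
  assumes "a > 0" "q > 0"
  shows "ennpowr (ennreal (a powr q) * ennpowr X q) (1 / q) = ennreal a * X"
proof (cases X)
  case (real x)
  then have "ennreal (a powr q) * ennpowr X q = ennreal ((a * x) powr q)"
    using assms by (simp add: ennpowr_ennreal powr_mult ennreal_mult)
  then show ?thesis using real assms by (simp add: ennpowr_ennreal powr_powr ennreal_mult)
qed (use assms in \<open>simp add: ennreal_mult_top\<close>)

text \<open>One term of the series, for one pair in the supremum, is kept. The conditions
  \<open>i \<le> L1\<close> and \<open>j \<le> L2\<close> ensure that the cut to dyadic cubes leaves
  this shell intact.\<close>

lemma morrey_herz_norm_ge:
  fixes g :: "(real^'n) \<times> (real^'m) \<Rightarrow> 'v::real_normed_vector"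
  assumes q: "q > 0" and L: "i \<le> L1" "j \<le> L2"
  shows "ennreal (2 powr (- real_of_int (L1 + L2) * lam + real_of_int (i + j) * \<alpha>)) *
      Lp_norm p (cut (dyadic_shell i \<times> dyadic_shell j) g) \<le> morrey_herz_norm \<alpha> lam p q g"
proof -
  let ?g = "cut (dyadic_cube L1 \<times> dyadic_cube L2) g"
  let ?T = "\<lambda>(i, j). ennreal (2 powr (real_of_int (i + j) * q * \<alpha>)) * ennpowr (Lp_norm p (cut (dyadic_shell i \<times> dyadic_shell j) ?g)) q"
  have sub: "(dyadic_shell i \<times> dyadic_shell j) \<inter> (dyadic_cube L1 \<times> dyadic_cube L2) = dyadic_shell i \<times> dyadic_shell j"
    using dyadic_shell_inside[OF L(1)] dyadic_shell_inside[OF L(2)] by auto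
  have "2 powr (real_of_int (i + j) * q * \<alpha>) = (2 powr (real_of_int (i + j) * \<alpha>)) powr q"
    by (simp add: powr_powr mult_ac)
  then have "ennreal (2 powr (real_of_int (i + j) * \<alpha>)) * Lp_norm p (cut (dyadic_shell i \<times> dyadic_shell j) g)
     = ennpowr (?T (i, j)) (1 / q)"
    using q by (simp only: case_prod_conv cut_cut sub) (simp only: ennpowr_mult_powr powr_gt_zero)
  also have "\<dots> \<le> herz_norm \<alpha> p q ?g"
    unfolding herz_norm_def
  proof (rule ennpowr_mono)
    have "sum ?T {(i, j)} \<le> infsum ?T UNIV" 
      unfolding nonneg_infsum_complete[OF zero_le] by (intro SUP_upper) auto
    then show "?T (i, j) \<le> infsum ?T UNIV" by simp
  qed (use q in auto)
  finally have "ennreal (2 powr (- real_of_int (L1 + L2) * lam)) * (ennreal (2 powr (real_of_int (i + j) * \<alpha>)) *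
      Lp_norm p (cut (dyadic_shell i \<times> dyadic_shell j) g)) \<le> ennreal (2 powr (- real_of_int (L1 + L2) * lam)) * herz_norm \<alpha> p q ?g"
    by (rule mult_left_mono) simp
  also have "\<dots> \<le> morrey_herz_norm \<alpha> lam p q g"
    unfolding morrey_herz_norm_def by (rule SUP_upper2[of "(L1, L2)"]) auto
  finally show ?thesis by (simp add: powr_add ennreal_mult mult.assoc)
qed

text \<open>The decay exponents \<gamma> and \<delta> are left open so that the estimate serves both
  characteristic functions, where the measure of a shell gives n/p and m/p, and oscillations, where
  Hoelder's inequality gives less.\<close>

lemma morrey_herz_norm_le:
  fixes h :: "(real^'n) \<times> (real^'m) \<Rightarrow> 'v::real_normed_vector" and K1 K2 :: int
  assumes pq: "p > 0" "q > 0" and lam: "lam \<ge> 0" and V: "V \<ge> 0"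
    and \<rho>: "\<rho>1 > 0" "\<rho>2 > 0" "\<rho>1 = \<alpha> + \<gamma> - lam" "\<rho>2 = \<alpha> + \<delta> - lam"
    and R1: "\<And>i. i > K1 \<Longrightarrow> A \<inter> dyadic_shell i = {}"
    and R2: "\<And>j. j > K2 \<Longrightarrow> B \<inter> dyadic_shell j = {}"
    and bound: "\<And>i j. i \<le> K1 \<Longrightarrow> j \<le> K2 \<Longrightarrow>
      Lp_norm p (cut ((A \<inter> dyadic_shell i) \<times> (B \<inter> dyadic_shell j)) h)
        \<le> ennreal (V * 2 powr (\<gamma> * real_of_int (i - K1)) * 2 powr (\<delta> * real_of_int (j - K2)))"
  shows "morrey_herz_norm \<alpha> lam p q (cut (A \<times> B) h)
     \<le> ennreal ((geo (q * \<rho>1) * geo (q * \<rho>2)) powr (1 / q) * V * 2 powr (real_of_int (K1 + K2) * (\<alpha> - lam)))"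
  unfolding morrey_herz_norm_def
proof (rule SUP_least, clarify)
  fix L1 L2 :: int
  define T0 where "T0 = V * 2 powr (real_of_int (L1 + L2) * lam) * 2 powr (real_of_int (K1 + K2) * (\<alpha> - lam))"
  define S where "S = geo (q * \<rho>1) * geo (q * \<rho>2)"
  have T0: "T0 \<ge> 0" using V by (simp add: T0_def)
  have S: "S > 0" using geo_pos pq \<rho> by (simp add: S_def)
  let ?h = "cut (dyadic_cube L1 \<times> dyadic_cube L2) (cut (A \<times> B) h)"
  let ?T = "\<lambda>(i, j). ennreal (2 powr (real_of_int (i + j) * q * \<alpha>)) * ennpowr (Lp_norm p (cut (dyadic_shell i \<times> dyadic_shell j) ?h)) q"
  let ?G = "{(i, j). i \<le> K1 \<and> j \<le> K2}"
  have set_eq: "dyadic_shell i \<times> dyadic_shell j \<inter> (dyadic_cube L1 \<times> dyadic_cube L2) \<inter> A \<times> B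
    = (A \<inter> dyadic_shell i \<inter> dyadic_cube L1) \<times> (B \<inter> dyadic_shell j \<inter> dyadic_cube L2)" for i j
    by auto
  have zero: "?T (i, j) = 0" if "i > L1 \<or> j > L2 \<or> i > K1 \<or> j > K2" for i j
  proof -
    have "(A \<inter> dyadic_shell i \<inter> dyadic_cube L1) \<times> (B \<inter> dyadic_shell j \<inter> dyadic_cube L2) = {}"
      using that R1[of i] R2[of j] dyadic_shell_outside[of L1 i] dyadic_shell_outside[of L2 j] by blast
    then have "Lp_norm p (cut (dyadic_shell i \<times> dyadic_shell j) ?h) = 0"
      unfolding cut_cut Int_assoc[symmetric] set_eq by (simp only: Lp_norm_cut_empty)
    then show ?thesis by (simp add: ennpowr_def)
  qed
  have le: "?T (i, j) \<le> ennreal (T0 powr q * (2 powr (q * \<rho>1 * real_of_int (i - K1)) * 2 powr (q * \<rho>2 * real_of_int (j - K2))))"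
    if ij: "i \<le> K1" "j \<le> K2" for i j
  proof (cases "i > L1 \<or> j > L2")
    case True
    then have "?T (i, j) = 0" using zero by blast
    then show ?thesis by simp
  next
    case False
    let ?v = "V * 2 powr (\<gamma> * real_of_int (i - K1)) * 2 powr (\<delta> * real_of_int (j - K2))"
    have v: "?v \<ge> 0" using V by simp
    have "Lp_norm p (cut (dyadic_shell i \<times> dyadic_shell j) ?h)
       \<le> Lp_norm p (cut ((A \<inter> dyadic_shell i) \<times> (B \<inter> dyadic_shell j)) h)"
      unfolding cut_cut Int_assoc[symmetric] set_eq using pq by (intro Lp_norm_cut_mono) auto
    also have "\<dots> \<le> ennreal ?v" using ij by (rule bound)
    finally have "?T (i, j) \<le> ennreal (2 powr (real_of_int (i + j) * q * \<alpha>)) * ennpowr (ennreal ?v) q"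
      using pq by (simp add: mult_left_mono ennpowr_mono)
    also have "\<dots> = ennreal (2 powr (real_of_int (i + j) * q * \<alpha>) * ?v powr q)"
      using v by (simp only: ennpowr_ennreal) (simp add: ennreal_mult)
    also have "2 powr (real_of_int (i + j) * q * \<alpha>) * ?v powr q = (2 powr (real_of_int (i + j) * \<alpha>) * ?v) powr q"
      using v by (subst (2) powr_mult) (auto simp: powr_powr mult_ac)
    also have "\<dots> \<le> (T0 * (2 powr (\<rho>1 * real_of_int (i - K1)) * 2 powr (\<rho>2 * real_of_int (j - K2)))) powr q"
    proof (rule powr_mono2)
      \<comment> \<open>The exponent \<alpha> is split as (\<alpha> - \<open>lam\<close>) +
        \<open>lam\<close>. The first part produces the geometric decay with exponents
        \<open>\<rho>1\<close> and \<open>\<rho>2\<close>. The second is bounded through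
        \<open>i \<le> L1\<close> and \<open>j \<le> L2\<close> and is cancelled at the end by the
        Morrey weight, so the result is independent of \<open>L1\<close> and
        \<open>L2\<close>.\<close>
      have exps: "real_of_int (i + j) * \<alpha> + \<gamma> * real_of_int (i - K1) + \<delta> * real_of_int (j - K2)
        = real_of_int (K1 + K2) * (\<alpha> - lam) + \<rho>1 * real_of_int (i - K1) + \<rho>2 * real_of_int (j - K2) + real_of_int (i + j) * lam"
        unfolding \<rho>(3,4) by (simp add: algebra_simps)
      have "2 powr (real_of_int (i + j) * \<alpha>) * ?v
        = V * 2 powr (real_of_int (i + j) * \<alpha> + \<gamma> * real_of_int (i - K1) + \<delta> * real_of_int (j - K2))"
        by (simp only: powr_add mult_ac)
      also have "\<dots> = V * 2 powr (real_of_int (K1 + K2) * (\<alpha> - lam)) * 2 powr (\<rho>1 * real_of_int (i - K1)) * 2 powr (\<rho>2 * real_of_int (j - K2)) * 2 powr (real_of_int (i + j) * lam)"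
        unfolding exps by (simp only: powr_add mult_ac)
      finally have eq: "2 powr (real_of_int (i + j) * \<alpha>) * ?v
        = V * 2 powr (real_of_int (K1 + K2) * (\<alpha> - lam)) * 2 powr (\<rho>1 * real_of_int (i - K1)) * 2 powr (\<rho>2 * real_of_int (j - K2)) * 2 powr (real_of_int (i + j) * lam)" .
      have "real_of_int (i + j) * lam \<le> real_of_int (L1 + L2) * lam"
        using False lam by (intro mult_right_mono) auto
      then have "2 powr (real_of_int (i + j) * lam) \<le> 2 powr (real_of_int (L1 + L2) * lam)" by (intro powr_mono) auto
      then have "V * 2 powr (real_of_int (K1 + K2) * (\<alpha> - lam)) * 2 powr (\<rho>1 * real_of_int (i - K1)) * 2 powr (\<rho>2 * real_of_int (j - K2)) * 2 powr (real_of_int (i + j) * lam)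
         \<le> V * 2 powr (real_of_int (K1 + K2) * (\<alpha> - lam)) * 2 powr (\<rho>1 * real_of_int (i - K1)) * 2 powr (\<rho>2 * real_of_int (j - K2)) * 2 powr (real_of_int (L1 + L2) * lam)"
        using V by (intro mult_left_mono) auto
      also have "\<dots> = T0 * (2 powr (\<rho>1 * real_of_int (i - K1)) * 2 powr (\<rho>2 * real_of_int (j - K2)))"
        by (simp only: T0_def mult_ac)
      finally show "2 powr (real_of_int (i + j) * \<alpha>) * ?v \<le> T0 * (2 powr (\<rho>1 * real_of_int (i - K1)) * 2 powr (\<rho>2 * real_of_int (j - K2)))"
        unfolding eq .
    qed (use pq v in auto)
    also have "\<dots> = T0 powr q * (2 powr (q * \<rho>1 * real_of_int (i - K1)) * 2 powr (q * \<rho>2 * real_of_int (j - K2)))"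
      using T0 by (simp add: powr_mult powr_powr mult_ac)
    finally show ?thesis using v by (simp add: ennreal_leI)
  qed
  have "infsum ?T UNIV \<le> ennreal (T0 powr q * S)"
    unfolding nonneg_infsum_complete[OF zero_le]
  proof (rule SUP_least)
    fix F :: "(int \<times> int) set" assume "F \<in> {F. finite F \<and> F \<subseteq> UNIV}"
    then have F: "finite F" by simp
    have "sum ?T F = sum ?T (F \<inter> ?G)"
    proof (rule sum.mono_neutral_right[OF F])
      show "\<forall>ij\<in>F - F \<inter> ?G. ?T ij = 0"
      proof
        fix ij assume ij: "ij \<in> F - F \<inter> ?G"
        obtain i j where eq: "ij = (i, j)" by (cases ij)
        have "i > L1 \<or> j > L2 \<or> i > K1 \<or> j > K2" using ij eq by auto
        then show "?T ij = 0" unfolding eq by (rule zero)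
      qed
    qed auto
    also have "\<dots> \<le> (\<Sum>(i, j)\<in>F \<inter> ?G. ennreal (T0 powr q * (2 powr (q * \<rho>1 * real_of_int (i - K1)) * 2 powr (q * \<rho>2 * real_of_int (j - K2)))))"
    proof (rule sum_mono)
      fix ij assume ij: "ij \<in> F \<inter> ?G"
      obtain i j where eq: "ij = (i, j)" by (cases ij)
      show "?T ij \<le> (case ij of (i, j) \<Rightarrow> ennreal (T0 powr q * (2 powr (q * \<rho>1 * real_of_int (i - K1)) * 2 powr (q * \<rho>2 * real_of_int (j - K2)))))"
        using le[of i j] ij unfolding eq by simp
    qed
    also have "\<dots> = ennreal (T0 powr q * (\<Sum>(i, j)\<in>F \<inter> ?G. 2 powr (q * \<rho>1 * real_of_int (i - K1)) * 2 powr (q * \<rho>2 * real_of_int (j - K2))))"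
      by (simp add: case_prod_unfold sum_distrib_left)
    also have "\<dots> \<le> ennreal (T0 powr q * S)"
      unfolding S_def using F \<rho> pq by (intro ennreal_leI mult_left_mono sum_pair_powr_le_geo) auto
    finally show "sum ?T F \<le> ennreal (T0 powr q * S)" .
  qed
  then have "herz_norm \<alpha> p q ?h \<le> ennpowr (ennreal (T0 powr q * S)) (1 / q)"
    unfolding herz_norm_def using pq by (intro ennpowr_mono) auto
  also have "\<dots> = ennreal (T0 * S powr (1 / q))"
    using T0 S pq by (simp add: ennpowr_ennreal powr_mult powr_powr)
  finally have "ennreal (2 powr (- real_of_int (L1 + L2) * lam)) * herz_norm \<alpha> p q ?h
     \<le> ennreal (2 powr (- real_of_int (L1 + L2) * lam)) * ennreal (T0 * S powr (1 / q))"
    by (rule mult_left_mono) simp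
  also have "\<dots> = ennreal (2 powr (- real_of_int (L1 + L2) * lam) * (T0 * S powr (1 / q)))"
    using T0 by (simp add: ennreal_mult)
  also have "2 powr (- real_of_int (L1 + L2) * lam) * (T0 * S powr (1 / q))
    = (2 powr (- real_of_int (L1 + L2) * lam) * 2 powr (real_of_int (L1 + L2) * lam)) * (S powr (1 / q) * V * 2 powr (real_of_int (K1 + K2) * (\<alpha> - lam)))"
    by (simp only: T0_def mult_ac)
  also have "2 powr (- real_of_int (L1 + L2) * lam) * 2 powr (real_of_int (L1 + L2) * lam) = 1"
    by (simp flip: powr_add add: algebra_simps)
  finally show "ennreal (2 powr (- real_of_int (L1 + L2) * lam)) * herz_norm \<alpha> p q ?h
     \<le> ennreal ((geo (q * \<rho>1) * geo (q * \<rho>2)) powr (1 / q) * V * 2 powr (real_of_int (K1 + K2) * (\<alpha> - lam)))"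
    unfolding S_def by simp
qed

section \<open>Exhausting the product space by shells\<close>

lemma exists_dyadic_shell:
  fixes u :: "real^'n" assumes "u \<noteq> 0" shows "\<exists>i. u \<in> dyadic_shell i"
proof -
  define h where "h = Max (range (\<lambda>i. \<bar>u $ i\<bar>))"
  have h_ge: "\<bar>u $ i\<bar> \<le> h" for i unfolding h_def by (intro Max_ge) auto
  have "h \<in> range (\<lambda>i. \<bar>u $ i\<bar>)" unfolding h_def by (intro Max_in) auto
  then obtain j where j: "\<bar>u $ j\<bar> = h" by blast
  obtain i where "u $ i \<noteq> 0" using assms by (auto simp: vec_eq_iff)
  then have "h > 0" using h_ge[of i] by linarith
  then obtain K :: int where K: "2 powi K / 4 < h" "h \<le> 2 powi K / 2" using exists_dyadic_scale by blast
  have "u \<in> dyadic_cube K" unfolding mem_dyadic_cube using h_ge K by (meson order_trans)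
  moreover have "2 powi (K - 1) / 2 = (2::real) powi K / 4" by (simp add: power_int_diff)
  then have "u \<notin> dyadic_cube (K - 1)" unfolding mem_dyadic_cube using j K by (metis linorder_not_less)
  ultimately show ?thesis by (auto simp: dyadic_shell_def)
qed

text \<open>In each factor the shells miss exactly the origin, so the exceptional set is the union
  of two coordinate subspaces, each of product measure 0.\<close>

lemma AE_dyadic_shells:
  "AE z in (lebesgue :: ((real^'n) \<times> (real^'m)) measure). \<exists>i j. z \<in> dyadic_shell i \<times> dyadic_shell j"
proof (rule AE_I')
  have "{0} \<times> UNIV \<in> null_sets (lebesgue :: ((real^'n) \<times> (real^'m)) measure)"
    "UNIV \<times> {0} \<in> null_sets (lebesgue :: ((real^'n) \<times> (real^'m)) measure)"
    by (auto simp: null_sets_def emeasure_lebesgue_Times borel_Times simp del: emeasure_completion)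
  then show "{0} \<times> UNIV \<union> UNIV \<times> {0} \<in> null_sets (lebesgue :: ((real^'n) \<times> (real^'m)) measure)"
    by (rule null_sets.Un)
  show "{z \<in> space lebesgue. \<not> (\<exists>i j. z \<in> dyadic_shell i \<times> dyadic_shell j)}
     \<subseteq> ({0} \<times> UNIV \<union> UNIV \<times> {0} :: ((real^'n) \<times> (real^'m)) set)"
  proof (rule subsetI, rule ccontr)
    fix z :: "(real^'n) \<times> (real^'m)"
    assume no: "z \<in> {z \<in> space lebesgue. \<not> (\<exists>i j. z \<in> dyadic_shell i \<times> dyadic_shell j)}"
      and "z \<notin> {0} \<times> UNIV \<union> UNIV \<times> {0}"
    then have "fst z \<noteq> 0" "snd z \<noteq> 0" by (auto simp: mem_Times_iff)
    then obtain i j where "fst z \<in> dyadic_shell i" "snd z \<in> dyadic_shell j" using exists_dyadic_shell by metis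
    then have "z \<in> dyadic_shell i \<times> dyadic_shell j" by (simp add: mem_Times_iff)
    then show False using no by blast
  qed
qed

text \<open>The shells cover almost everything, and the pairs of integers are enumerated by the
  naturals to interchange integral and series. Bounds on finite partial sums suffice, in the form
  that the geometric estimates supply.\<close>

lemma nn_integral_shells_le:
  fixes A :: "(real^'n) set" and B :: "(real^'m) set" and u :: "(real^'n) \<times> (real^'m) \<Rightarrow> real"
  assumes AB: "A \<in> sets borel" "B \<in> sets borel"
    and u: "\<And>z. u z \<ge> 0" "(\<lambda>z. indicator (A \<times> B) z * u z) \<in> borel_measurable lebesgue"
    and S: "\<And>F. finite F \<Longrightarrow> (\<Sum>(i, j)\<in>F. \<integral>\<^sup>+z. ennreal (indicator ((A \<inter> dyadic_shell i) \<times> (B \<inter> dyadic_shell j)) z * u z) \<partial>lebesgue) \<le> S"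
  shows "(\<integral>\<^sup>+z. ennreal (indicator (A \<times> B) z * u z) \<partial>lebesgue) \<le> S"
proof -
  let ?A = "\<lambda>(i, j). (A \<inter> dyadic_shell i) \<times> (B \<inter> dyadic_shell j)"
  obtain e :: "int \<times> int \<Rightarrow> nat" where e: "bij_betw e UNIV UNIV"
    using countableE_infinite[of "UNIV :: (int \<times> int) set"]
    by (metis countableI_type finite_prod infinite_UNIV_int UNIV_Times_UNIV finite_cartesian_productD1 UNIV_not_empty)
  define e' where "e' = inv e"
  have e': "bij_betw e' UNIV UNIV" unfolding e'_def using e by (rule bij_imp_bij_inv)
  have meas: "(\<lambda>z. ennreal (indicator (?A ij) z * u z)) \<in> borel_measurable lebesgue" for ij
  proof -
    have [measurable]: "?A ij \<in> sets lebesgue"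
      using AB by (auto intro!: borel_Times sets.Int borel_dyadic_shell split: prod.splits)
    note u(2)[measurable]
    have "(\<lambda>z. ennreal (indicator (?A ij) z * (indicator (A \<times> B) z * u z))) \<in> borel_measurable lebesgue" by measurable
    moreover have "indicator (?A ij) z * (indicator (A \<times> B) z * u z) = indicator (?A ij) z * u z" for z
      by (auto simp: indicator_def split: prod.splits)
    ultimately show ?thesis by simp
  qed
  have "(\<integral>\<^sup>+z. ennreal (indicator (A \<times> B) z * u z) \<partial>lebesgue) \<le> (\<integral>\<^sup>+z. (\<Sum>n. ennreal (indicator (?A (e' n)) z * u z)) \<partial>lebesgue)"
  proof (rule nn_integral_mono_AE, use AE_dyadic_shells in eventually_elim)
    fix z :: "(real^'n) \<times> (real^'m)" assume "\<exists>i j. z \<in> dyadic_shell i \<times> dyadic_shell j"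
    then obtain i j where ij: "z \<in> dyadic_shell i \<times> dyadic_shell j" by blast
    obtain n where n: "e' n = (i, j)" using e' by (metis bij_betw_def surj_def)
    show "ennreal (indicator (A \<times> B) z * u z) \<le> (\<Sum>n. ennreal (indicator (?A (e' n)) z * u z))"
    proof (cases "z \<in> A \<times> B")
      case True
      then have "ennreal (indicator (A \<times> B) z * u z) = (\<Sum>n\<in>{n}. ennreal (indicator (?A (e' n)) z * u z))"
        using ij n by (auto simp: indicator_def)
      also have "\<dots> \<le> (\<Sum>n. ennreal (indicator (?A (e' n)) z * u z))" by (rule sum_le_suminf) auto
      finally show ?thesis .
    qed simp
  qed
  also have "\<dots> = (\<Sum>n. \<integral>\<^sup>+z. ennreal (indicator (?A (e' n)) z * u z) \<partial>lebesgue)"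
    by (rule nn_integral_suminf[OF meas])
  also have "\<dots> \<le> S"
  proof (rule suminf_le_const)
    fix n
    have inj: "inj_on e' {..<n}" using e' by (meson bij_betw_def inj_on_subset subset_UNIV)
    have "(\<Sum>n<n. \<integral>\<^sup>+z. ennreal (indicator (?A (e' n)) z * u z) \<partial>lebesgue)
      = (\<Sum>ij\<in>e' ` {..<n}. \<integral>\<^sup>+z. ennreal (indicator (?A ij) z * u z) \<partial>lebesgue)"
      by (simp add: sum.reindex[OF inj])
    also have "\<dots> = (\<Sum>(i, j)\<in>e' ` {..<n}. \<integral>\<^sup>+z. ennreal (indicator ((A \<inter> dyadic_shell i) \<times> (B \<inter> dyadic_shell j)) z * u z) \<partial>lebesgue)"
      by (intro sum.cong) auto
    also have "\<dots> \<le> S" by (rule S) auto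
    finally show "(\<Sum>n<n. \<integral>\<^sup>+z. ennreal (indicator (?A (e' n)) z * u z) \<partial>lebesgue) \<le> S" .
  qed auto
  finally show ?thesis .
qed

text \<open>Here \<open>a\<close> plays the role of \<open>|A|\<close> and \<open>K\<close> is the scale described at the top.\<close>

definition shell_controlled :: "(real^'n) set \<Rightarrow> real \<Rightarrow> int \<Rightarrow> bool" where
  "shell_controlled A a K \<longleftrightarrow> compact A \<and> a > 0 \<and> (\<forall>i>K. A \<inter> dyadic_shell i = {}) \<and>
     (\<forall>i\<le>K. measure lborel (A \<inter> dyadic_shell i) \<le> 8 ^ CARD('n) * a * 2 powr (real CARD('n) * real_of_int (i - K))) \<and>
     (\<exists>i\<in>{K - 1, K}. a / 32 \<le> measure lborel (A \<inter> dyadic_shell i))"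

lemma shell_controlled_cube:
  fixes x :: "real^'n"
  assumes r: "r > 0" shows "\<exists>K. shell_controlled (cube x r) (r ^ CARD('n)) K"
proof -
  obtain K :: int where K:
    "\<And>i. i > K \<Longrightarrow> cube x r \<inter> dyadic_shell i = {}"
    "\<And>i. i \<le> K \<Longrightarrow> measure lborel (cube x r \<inter> dyadic_shell i) \<le> (8 * 2 powi (i - K) * r) ^ CARD('n)"
    "\<exists>i\<in>{K - 1, K}. r ^ CARD('n) / 32 \<le> measure lborel (cube x r \<inter> dyadic_shell i)"
    using cube_shell_geometry[OF r] by metis
  have "(8 * 2 powi (i - K) * r) ^ CARD('n) = 8 ^ CARD('n) * r ^ CARD('n) * 2 powr (real CARD('n) * real_of_int (i - K))" for i
  proof -
    have "(2 powi (i - K)) ^ CARD('n) = (2 powr real_of_int (i - K)) powr real CARD('n)"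
      by (simp add: powr_realpow powr_real_of_int' del: of_int_diff)
    also have "\<dots> = 2 powr (real CARD('n) * real_of_int (i - K))" by (simp add: powr_powr mult.commute)
    finally show ?thesis by (simp add: power_mult_distrib)
  qed
  then show ?thesis unfolding shell_controlled_def using K r compact_cube by (intro exI[of _ K]) auto
qed

lemma Lp_norm_cut_1:
  assumes "S \<in> sets lebesgue"
  shows "Lp_norm p (cut S (\<lambda>_. 1 :: real)) = ennpowr (emeasure lebesgue S) (1 / p)"
  using assms by (simp add: Lp_norm_cut ennreal_indicator del: emeasure_completion)

section \<open>Two-sided estimates over a product of shell-controlled sets\<close>

context
  fixes A :: "(real^'n) set" and B :: "(real^'m) set" and a b :: real and K1 K2 :: int
    and \<alpha> lam p q :: real
  assumes A: "shell_controlled A a K1" and B: "shell_controlled B b K2"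
    and p: "p > 1" and q: "q > 1" and lam: "lam > 0"
begin

abbreviation shell :: "int \<Rightarrow> int \<Rightarrow> ((real^'n) \<times> (real^'m)) set" where
  "shell i j \<equiv> (A \<inter> dyadic_shell i) \<times> (B \<inter> dyadic_shell j)"

lemma ab: "a > 0" "b > 0" using A B by (simp_all add: shell_controlled_def)

lemma AB_borel: "A \<in> sets borel" "B \<in> sets borel"
  using A B by (auto simp: shell_controlled_def borel_compact)

lemma shell_sets [simp]: "shell i j \<in> sets lebesgue"
proof -
  have "shell i j \<in> sets borel" by (intro borel_Times sets.Int AB_borel borel_dyadic_shell)
  then show ?thesis by simp
qed

lemma emeasure_shell: "emeasure lebesgue (shell i j) =
   ennreal (measure lborel (A \<inter> dyadic_shell i) * measure lborel (B \<inter> dyadic_shell j))"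
proof -
  have "compact A" "compact B" using A B by (simp_all add: shell_controlled_def)
  then have "A \<inter> dyadic_shell i \<in> fmeasurable lborel" "B \<inter> dyadic_shell j \<in> fmeasurable lborel"
    using AB_borel borel_dyadic_shell
    by (simp_all add: fmeasurableI2[OF fmeasurable_compact] sets.Int)
  moreover note emeasure_eq_measure2[of "A \<inter> dyadic_shell i" lborel] emeasure_eq_measure2[of "B \<inter> dyadic_shell j" lborel]
  moreover have "emeasure lebesgue (shell i j) = emeasure lborel (A \<inter> dyadic_shell i) * emeasure lborel (B \<inter> dyadic_shell j)"
    by (intro emeasure_lebesgue_Times sets.Int AB_borel borel_dyadic_shell)
  ultimately show ?thesis by (simp add: emeasure_eq_measure2 ennreal_mult)
qed

lemma emeasure_shell_le:
  assumes "i \<le> K1" "j \<le> K2"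
  shows "emeasure lebesgue (shell i j) \<le>
     ennreal ((8 ^ (CARD('n) + CARD('m))) * (a * b) * 2 powr (real CARD('n) * real_of_int (i - K1)) * 2 powr (real CARD('m) * real_of_int (j - K2)))"
proof -
  have "measure lborel (A \<inter> dyadic_shell i) * measure lborel (B \<inter> dyadic_shell j)
     \<le> (8 ^ CARD('n) * a * 2 powr (real CARD('n) * real_of_int (i - K1))) * (8 ^ CARD('m) * b * 2 powr (real CARD('m) * real_of_int (j - K2)))"
    using A B assms ab unfolding shell_controlled_def by (intro mult_mono) auto
  then show ?thesis unfolding emeasure_shell by (intro ennreal_leI) (simp add: power_add mult_ac)
qed

lemma morrey_herz_indicator_le:
  assumes "lam < \<alpha> + real CARD('n) / p" "lam < \<alpha> + real CARD('m) / p"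
  shows "morrey_herz_norm \<alpha> lam p q (indicator (A \<times> B) :: _ \<Rightarrow> real)
     \<le> ennreal ((geo (q * (\<alpha> + real CARD('n) / p - lam)) * geo (q * (\<alpha> + real CARD('m) / p - lam))) powr (1 / q) * (8 ^ (CARD('n) + CARD('m))) powr (1 / p)
         * ((a * b) powr (1 / p) * 2 powr (real_of_int (K1 + K2) * (\<alpha> - lam))))"
proof -
  have eq: "(indicator (A \<times> B) :: _ \<Rightarrow> real) = cut (A \<times> B) (\<lambda>_. 1)" by (auto simp: cut_def)
  have bd: "Lp_norm p (cut (shell i j) (\<lambda>_. 1 :: real)) \<le> ennreal (((8 ^ (CARD('n) + CARD('m))) powr (1 / p) * (a * b) powr (1 / p)) *
      2 powr ((real CARD('n) / p) * real_of_int (i - K1)) * 2 powr ((real CARD('m) / p) * real_of_int (j - K2)))"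
    if "i \<le> K1" "j \<le> K2" for i j
  proof -
    have "Lp_norm p (cut (shell i j) (\<lambda>_. 1 :: real)) \<le>
      ennpowr (ennreal ((8 ^ (CARD('n) + CARD('m))) * (a * b) * 2 powr (real CARD('n) * real_of_int (i - K1)) * 2 powr (real CARD('m) * real_of_int (j - K2)))) (1 / p)"
      unfolding Lp_norm_cut_1[OF shell_sets] using p emeasure_shell_le[OF that] by (intro ennpowr_mono) auto
    also have "\<dots> = ennreal (((8 ^ (CARD('n) + CARD('m))) * (a * b) * 2 powr (real CARD('n) * real_of_int (i - K1)) * 2 powr (real CARD('m) * real_of_int (j - K2))) powr (1 / p))"
      using ab by (intro ennpowr_ennreal) auto
    also have "((8 ^ (CARD('n) + CARD('m))) * (a * b) * 2 powr (real CARD('n) * real_of_int (i - K1)) * 2 powr (real CARD('m) * real_of_int (j - K2))) powr (1 / p)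
      = (8 ^ (CARD('n) + CARD('m))) powr (1 / p) * (a * b) powr (1 / p) * (2 powr (real CARD('n) * real_of_int (i - K1))) powr (1 / p) * (2 powr (real CARD('m) * real_of_int (j - K2))) powr (1 / p)"
      using ab by (simp only: powr_mult)
    finally show ?thesis by (simp add: powr_powr)
  qed
  have "morrey_herz_norm \<alpha> lam p q (indicator (A \<times> B) :: _ \<Rightarrow> real)
     \<le> ennreal ((geo (q * (\<alpha> + real CARD('n) / p - lam)) * geo (q * (\<alpha> + real CARD('m) / p - lam))) powr (1 / q) *
       ((8 ^ (CARD('n) + CARD('m))) powr (1 / p) * (a * b) powr (1 / p)) * 2 powr (real_of_int (K1 + K2) * (\<alpha> - lam)))"
    unfolding eq
    by (rule morrey_herz_norm_le[where \<gamma> = "real CARD('n) / p" and \<delta> = "real CARD('m) / p"])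
      (use p q lam assms A B bd in \<open>auto simp: shell_controlled_def\<close>)
  then show ?thesis by (simp only: mult_ac)
qed

text \<open>A single shell in each factor, of scale \<open>K\<close> or \<open>K - 1\<close>,
  already carries the norm when the supremum is tested at \<open>(K1, K2)\<close>. The constant
  1/1024 is the square of 1/32, and the power of 2 pays for moving each of the two scales by at most
  one. The bound also makes the denominators positive.\<close>

lemma morrey_herz_indicator_ge:
  "ennreal (2 powr (- 2 * \<bar>\<alpha>\<bar>) * (1 / 1024) powr (1 / p) * ((a * b) powr (1 / p) * 2 powr (real_of_int (K1 + K2) * (\<alpha> - lam))))
     \<le> morrey_herz_norm \<alpha> lam p q (indicator (A \<times> B) :: _ \<Rightarrow> real)"
proof -
  have eq: "(indicator (A \<times> B) :: _ \<Rightarrow> real) = cut (A \<times> B) (\<lambda>_. 1)" by (auto simp: cut_def)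
  obtain i where i: "i \<in> {K1 - 1, K1}" "a / 32 \<le> measure lborel (A \<inter> dyadic_shell i)"
    using A unfolding shell_controlled_def by blast
  obtain j where j: "j \<in> {K2 - 1, K2}" "b / 32 \<le> measure lborel (B \<inter> dyadic_shell j)"
    using B unfolding shell_controlled_def by blast
  have "a / 32 * (b / 32) \<le> measure lborel (A \<inter> dyadic_shell i) * measure lborel (B \<inter> dyadic_shell j)"
    using i j ab by (intro mult_mono) auto
  then have "ennreal ((1 / 1024) * (a * b)) \<le> emeasure lebesgue (shell i j)"
    unfolding emeasure_shell by (intro ennreal_leI) simp
  then have "ennpowr (ennreal ((1 / 1024) * (a * b))) (1 / p) \<le> ennpowr (emeasure lebesgue (shell i j)) (1 / p)"
    using p by (intro ennpowr_mono) auto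
  also have "ennpowr (ennreal ((1 / 1024) * (a * b))) (1 / p) = ennreal ((1 / 1024) powr (1 / p) * (a * b) powr (1 / p))"
  proof -
    have "0 \<le> (1 / 1024) * (a * b)" using ab by simp
    then show ?thesis by (simp only: ennpowr_ennreal powr_mult)
  qed
  also have "ennpowr (emeasure lebesgue (shell i j)) (1 / p) = Lp_norm p (cut (dyadic_shell i \<times> dyadic_shell j) (indicator (A \<times> B) :: _ \<Rightarrow> real))"
  proof -
    have "dyadic_shell i \<times> dyadic_shell j \<inter> A \<times> B = shell i j" by auto
    then show ?thesis unfolding eq cut_cut by (simp only: Lp_norm_cut_1[OF shell_sets])
  qed
  finally have Lp: "ennreal ((1 / 1024) powr (1 / p) * (a * b) powr (1 / p))
     \<le> Lp_norm p (cut (dyadic_shell i \<times> dyadic_shell j) (indicator (A \<times> B) :: _ \<Rightarrow> real))" .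
  have "\<alpha> * real_of_int (i + j) \<ge> \<alpha> * real_of_int (K1 + K2) - 2 * \<bar>\<alpha>\<bar>"
  proof -
    have "\<bar>\<alpha> * (real_of_int (K1 + K2) - real_of_int (i + j))\<bar> \<le> \<bar>\<alpha>\<bar> * 2"
      unfolding abs_mult using i(1) j(1) by (intro mult_left_mono) auto
    then show ?thesis by (simp add: algebra_simps abs_le_iff)
  qed
  then have "2 powr (- 2 * \<bar>\<alpha>\<bar> + real_of_int (K1 + K2) * (\<alpha> - lam)) \<le> 2 powr (- real_of_int (K1 + K2) * lam + real_of_int (i + j) * \<alpha>)"
    by (intro powr_mono) (auto simp: algebra_simps)
  then have "ennreal (2 powr (- 2 * \<bar>\<alpha>\<bar> + real_of_int (K1 + K2) * (\<alpha> - lam))) * ennreal ((1 / 1024) powr (1 / p) * (a * b) powr (1 / p))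
     \<le> ennreal (2 powr (- real_of_int (K1 + K2) * lam + real_of_int (i + j) * \<alpha>)) *
        Lp_norm p (cut (dyadic_shell i \<times> dyadic_shell j) (indicator (A \<times> B) :: _ \<Rightarrow> real))"
    using Lp by (intro mult_mono ennreal_leI) auto
  also have "\<dots> \<le> morrey_herz_norm \<alpha> lam p q (indicator (A \<times> B) :: _ \<Rightarrow> real)"
    using q i j by (intro morrey_herz_norm_ge) auto
  also have "ennreal (2 powr (- 2 * \<bar>\<alpha>\<bar> + real_of_int (K1 + K2) * (\<alpha> - lam))) * ennreal ((1 / 1024) powr (1 / p) * (a * b) powr (1 / p))
    = ennreal (2 powr (- 2 * \<bar>\<alpha>\<bar> + real_of_int (K1 + K2) * (\<alpha> - lam)) * ((1 / 1024) powr (1 / p) * (a * b) powr (1 / p)))"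
    by (rule ennreal_mult[symmetric]) auto
  finally show ?thesis by (simp only: powr_add mult_ac)
qed

lemma shell_measurable:
  fixes g :: "(real^'n) \<times> (real^'m) \<Rightarrow> 'v::{banach, second_countable_topology}"
  assumes "(\<lambda>z. indicator (A \<times> B) z * norm (g z)) \<in> borel_measurable lebesgue"
  shows "(\<lambda>z. indicator (shell i j) z * norm (g z)) \<in> borel_measurable lebesgue"
proof -
  note assms[measurable] shell_sets[of i j, measurable]
  have "(\<lambda>z. indicator (shell i j) z * (indicator (A \<times> B) z * norm (g z))) \<in> borel_measurable lebesgue" by measurable
  moreover have "indicator (shell i j) z * (indicator (A \<times> B) z * norm (g z)) = indicator (shell i j) z * norm (g z)" for z
    by (auto simp: indicator_def)
  ultimately show ?thesis by simp
qed

text \<open>Hoelder's inequality with exponent \<open>t\<close> is applied to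
  \<open>norm (g z) powr p\<close> on each shell. The measure of the shell enters with the power
  \<open>1 - 1 / t\<close>, which leaves geometric decay, and the powers \<open>1 / t\<close> and
  \<open>1 - 1 / t\<close> of \<open>a * b\<close> recombine to \<open>a * b\<close>.\<close>

lemma morrey_herz_le_integral_powr:
  fixes g :: "(real^'n) \<times> (real^'m) \<Rightarrow> 'v::{banach, second_countable_topology}"
  assumes g: "(\<lambda>z. indicator (A \<times> B) z * norm (g z)) \<in> borel_measurable lebesgue"
    and t: "t > 1" and D: "D > 0"
    and int: "(\<integral>\<^sup>+z. ennreal (indicator (A \<times> B) z * norm (g z) powr (p * t)) \<partial>lebesgue) \<le> ennreal (D * (a * b))"
    and \<rho>: "\<alpha> + real CARD('n) * (1 - 1 / t) / p - lam > 0" "\<alpha> + real CARD('m) * (1 - 1 / t) / p - lam > 0"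
  shows "morrey_herz_norm \<alpha> lam p q (cut (A \<times> B) g)
     \<le> ennreal ((geo (q * (\<alpha> + real CARD('n) * (1 - 1 / t) / p - lam)) * geo (q * (\<alpha> + real CARD('m) * (1 - 1 / t) / p - lam))) powr (1 / q)
         * (2 * (8 ^ (CARD('n) + CARD('m))) powr (1 - 1 / t)) powr (1 / p) * D powr (1 / (p * t))
         * ((a * b) powr (1 / p) * 2 powr (real_of_int (K1 + K2) * (\<alpha> - lam))))"
proof -
  define \<kappa> where "\<kappa> = 1 - 1 / t"
  have \<kappa>: "\<kappa> > 0" using t by (simp add: \<kappa>_def)
  have bd: "Lp_norm p (cut (shell i j) g) \<le> ennreal (((2 * (8 ^ (CARD('n) + CARD('m))) powr \<kappa>) powr (1 / p) * D powr (1 / (p * t)) * (a * b) powr (1 / p)) *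
      2 powr ((real CARD('n) * \<kappa> / p) * real_of_int (i - K1)) * 2 powr ((real CARD('m) * \<kappa> / p) * real_of_int (j - K2)))"
    if ij: "i \<le> K1" "j \<le> K2" for i j
  proof -
    define e1 where "e1 = 2 powr (real CARD('n) * real_of_int (i - K1))"
    define e2 where "e2 = 2 powr (real CARD('m) * real_of_int (j - K2))"
    have e: "e1 > 0" "e2 > 0" by (simp_all add: e1_def e2_def)
    have gm: "(\<lambda>z. indicator (shell i j) z * norm (g z) powr p) \<in> borel_measurable lebesgue"
    proof -
      have "(\<lambda>z. indicator (shell i j) z * norm (g z) powr p) = (\<lambda>z. (indicator (shell i j) z * norm (g z)) powr p)"
        by (auto simp: indicator_def)
      moreover note shell_measurable[OF g, of i j, measurable]
      ultimately show ?thesis by simp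
    qed
    have "(\<integral>\<^sup>+z. ennreal (indicator (shell i j) z * norm (g z) powr p) \<partial>lebesgue)
       \<le> ennreal (2 * (D * (a * b)) powr (1 / t) * ((8 ^ (CARD('n) + CARD('m))) * (a * b) * e1 * e2) powr \<kappa>)"
      unfolding \<kappa>_def
    proof (rule nn_integral_powr_le[OF shell_sets])
      show "emeasure lebesgue (shell i j) \<le> ennreal ((8 ^ (CARD('n) + CARD('m))) * (a * b) * e1 * e2)"
        unfolding e1_def e2_def by (rule emeasure_shell_le[OF ij])
      have "(\<integral>\<^sup>+z. ennreal (indicator (shell i j) z * (norm (g z) powr p) powr t) \<partial>lebesgue)
        \<le> (\<integral>\<^sup>+z. ennreal (indicator (A \<times> B) z * norm (g z) powr (p * t)) \<partial>lebesgue)"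
        by (intro nn_integral_mono ennreal_leI) (auto simp: indicator_def powr_powr)
      also note int
      finally show "(\<integral>\<^sup>+z. ennreal (indicator (shell i j) z * (norm (g z) powr p) powr t) \<partial>lebesgue) \<le> ennreal (D * (a * b))" .
    qed (use t D ab e gm in auto)
    then have "Lp_norm p (cut (shell i j) g) \<le> ennpowr (ennreal (2 * (D * (a * b)) powr (1 / t) * ((8 ^ (CARD('n) + CARD('m))) * (a * b) * e1 * e2) powr \<kappa>)) (1 / p)"
      unfolding Lp_norm_cut using p by (intro ennpowr_mono) auto
    also have "\<dots> = ennreal ((2 * (D * (a * b)) powr (1 / t) * ((8 ^ (CARD('n) + CARD('m))) * (a * b) * e1 * e2) powr \<kappa>) powr (1 / p))"
      using ab D e by (intro ennpowr_ennreal) auto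
    also have "2 * (D * (a * b)) powr (1 / t) * ((8 ^ (CARD('n) + CARD('m))) * (a * b) * e1 * e2) powr \<kappa>
      = (2 * (8 ^ (CARD('n) + CARD('m))) powr \<kappa>) * D powr (1 / t) * ((a * b) powr (1 / t) * (a * b) powr \<kappa>) * e1 powr \<kappa> * e2 powr \<kappa>"
      by (simp only: powr_mult mult_ac)
    also have "(a * b) powr (1 / t) * (a * b) powr \<kappa> = a * b"
      using ab by (simp add: \<kappa>_def flip: powr_add)
    also have "((2 * (8 ^ (CARD('n) + CARD('m))) powr \<kappa>) * D powr (1 / t) * (a * b) * e1 powr \<kappa> * e2 powr \<kappa>) powr (1 / p)
      = (2 * (8 ^ (CARD('n) + CARD('m))) powr \<kappa>) powr (1 / p) * (D powr (1 / t)) powr (1 / p) * (a * b) powr (1 / p) * (e1 powr \<kappa>) powr (1 / p) * (e2 powr \<kappa>) powr (1 / p)"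
      by (simp only: powr_mult)
    finally show ?thesis by (simp add: e1_def e2_def powr_powr mult_ac)
  qed
  have "morrey_herz_norm \<alpha> lam p q (cut (A \<times> B) g)
     \<le> ennreal ((geo (q * (\<alpha> + real CARD('n) * \<kappa> / p - lam)) * geo (q * (\<alpha> + real CARD('m) * \<kappa> / p - lam))) powr (1 / q) *
       ((2 * (8 ^ (CARD('n) + CARD('m))) powr \<kappa>) powr (1 / p) * D powr (1 / (p * t)) * (a * b) powr (1 / p)) * 2 powr (real_of_int (K1 + K2) * (\<alpha> - lam)))"
    by (rule morrey_herz_norm_le[where \<gamma> = "real CARD('n) * \<kappa> / p" and \<delta> = "real CARD('m) * \<kappa> / p", OF _ _ _ _ _ _ refl refl _ _ bd])
      (use p q lam A B \<rho> in \<open>auto simp: shell_controlled_def \<kappa>_def\<close>)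
  then show ?thesis unfolding \<kappa>_def by (simp only: mult_ac)
qed

text \<open>The Morrey-Herz norm bounds the L^p norm on each shell, with a loss governed by
  -\<alpha>. Hoelder's inequality with exponent \<open>p\<close> gains the power
  \<open>1 - 1 / p\<close> of the shell measure, and the condition on \<alpha> says that the gain
  wins.\<close>

lemma integral_le_morrey_herz:
  fixes g :: "(real^'n) \<times> (real^'m) \<Rightarrow> 'v::{banach, second_countable_topology}"
  assumes g: "(\<lambda>z. indicator (A \<times> B) z * norm (g z)) \<in> borel_measurable lebesgue"
    and E: "E > 0"
    and le: "morrey_herz_norm \<alpha> lam p q (cut (A \<times> B) g) \<le> ennreal (E * ((a * b) powr (1 / p) * 2 powr (real_of_int (K1 + K2) * (\<alpha> - lam))))"
    and \<sigma>: "real CARD('n) * (1 - 1 / p) - \<alpha> > 0" "real CARD('m) * (1 - 1 / p) - \<alpha> > 0"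
  shows "(\<integral>\<^sup>+z. ennreal (indicator (A \<times> B) z * norm (g z)) \<partial>lebesgue)
     \<le> ennreal (2 * (8 ^ (CARD('n) + CARD('m))) powr (1 - 1 / p) * (geo (real CARD('n) * (1 - 1 / p) - \<alpha>) * geo (real CARD('m) * (1 - 1 / p) - \<alpha>)) * E * (a * b))"
proof (rule nn_integral_shells_le[OF AB_borel])
  fix F :: "(int \<times> int) set" assume F: "finite F"
  define \<sigma>1 \<sigma>2 where "\<sigma>1 = real CARD('n) * (1 - 1 / p) - \<alpha>" and "\<sigma>2 = real CARD('m) * (1 - 1 / p) - \<alpha>"
  define V where "V = 2 * (8 ^ (CARD('n) + CARD('m))) powr (1 - 1 / p) * E * (a * b)"
  have V: "V \<ge> 0" using E ab by (simp add: V_def)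
  let ?T = "\<lambda>(i, j). \<integral>\<^sup>+z. ennreal (indicator (shell i j) z * norm (g z)) \<partial>lebesgue"
  let ?G = "{(i, j). i \<le> K1 \<and> j \<le> K2}"
  have zero: "?T (i, j) = 0" if "i > K1 \<or> j > K2" for i j
  proof -
    have "shell i j = {}" using that A B unfolding shell_controlled_def by auto
    then show ?thesis unfolding case_prod_conv by (simp only:) simp
  qed
  have bd: "?T (i, j) \<le> ennreal (V * (2 powr (\<sigma>1 * real_of_int (i - K1)) * 2 powr (\<sigma>2 * real_of_int (j - K2))))"
    if ij: "i \<le> K1" "j \<le> K2" for i j
  proof -
    define W where "W = E * ((a * b) powr (1 / p) * 2 powr (real_of_int (K1 + K2) * (\<alpha> - lam)))"
    define w where "w = 2 powr (- real_of_int (K1 + K2) * lam + real_of_int (i + j) * \<alpha>)"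
    \<comment> \<open>Testing the supremum at \<open>(K1, K2)\<close> makes the dependence on
      \<open>lam\<close> cancel in this quotient.\<close>
    define U where "U = W / w"
    have pos: "W > 0" "w > 0" "U > 0" using E ab by (auto simp: W_def w_def U_def)
    have U: "U = E * (a * b) powr (1 / p) * (2 powr (- \<alpha> * real_of_int (i - K1)) * 2 powr (- \<alpha> * real_of_int (j - K2)))"
    proof -
      have "U = E * (a * b) powr (1 / p) * (2 powr (real_of_int (K1 + K2) * (\<alpha> - lam)) / w)"
        by (simp add: U_def W_def)
      also have "2 powr (real_of_int (K1 + K2) * (\<alpha> - lam)) / w
        = 2 powr (- \<alpha> * real_of_int (i - K1)) * 2 powr (- \<alpha> * real_of_int (j - K2))"
        unfolding w_def powr_diff[symmetric] powr_add[symmetric]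
        by (rule arg_cong[where f = "\<lambda>x. 2 powr x"]) (simp add: algebra_simps)
      finally show ?thesis .
    qed
    define Y where "Y = (8 ^ (CARD('n) + CARD('m))) * (a * b) * 2 powr (real CARD('n) * real_of_int (i - K1)) * 2 powr (real CARD('m) * real_of_int (j - K2))"
    have Y: "Y > 0" using ab by (simp add: Y_def)
    have "dyadic_shell i \<times> dyadic_shell j \<inter> A \<times> B = shell i j" by auto
    then have "ennreal w * Lp_norm p (cut (shell i j) g) \<le> morrey_herz_norm \<alpha> lam p q (cut (A \<times> B) g)"
      using morrey_herz_norm_ge[of q i K1 j K2 lam \<alpha> p "cut (A \<times> B) g"] q ij by (simp only: w_def cut_cut)
    also have "\<dots> \<le> ennreal W" using le by (simp only: W_def)
    finally have "ennreal w * Lp_norm p (cut (shell i j) g) \<le> ennreal W" .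
    \<comment> \<open>An infinite shell norm is excluded because \<open>w\<close> is positive and
      \<open>W\<close> finite.\<close>
    then have "Lp_norm p (cut (shell i j) g) \<le> ennreal U"
      using pos by (cases "Lp_norm p (cut (shell i j) g)")
        (auto simp: U_def ennreal_mult_top top_unique field_simps ennreal_le_iff simp flip: ennreal_mult)
    then have X: "(\<integral>\<^sup>+z. ennreal (indicator (shell i j) z * norm (g z) powr p) \<partial>lebesgue) \<le> ennreal (U powr p)"
      unfolding Lp_norm_cut using p pos by (intro ennpowr_le_ennrealD) auto
    have "?T (i, j) \<le> ennreal (2 * (U powr p) powr (1 / p) * Y powr (1 - 1 / p))"
      unfolding case_prod_conv
      by (rule nn_integral_powr_le[OF shell_sets _ _ Y _ _ shell_measurable[OF g] X])
        (use emeasure_shell_le[OF ij] p pos in \<open>auto simp: Y_def\<close>)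
    also have "(U powr p) powr (1 / p) = U" using p pos by (simp add: powr_powr)
    also have "2 * U * Y powr (1 - 1 / p)
       = 2 * (8 ^ (CARD('n) + CARD('m))) powr (1 - 1 / p) * E * ((a * b) powr (1 / p) * (a * b) powr (1 - 1 / p))
          * ((2 powr (- \<alpha> * real_of_int (i - K1)) * 2 powr (real CARD('n) * (1 - 1 / p) * real_of_int (i - K1)))
          * (2 powr (- \<alpha> * real_of_int (j - K2)) * 2 powr (real CARD('m) * (1 - 1 / p) * real_of_int (j - K2))))"
      unfolding U Y_def powr_mult powr_powr by (simp only: mult_ac)
    also have "(a * b) powr (1 / p) * (a * b) powr (1 - 1 / p) = a * b"
      using ab by (simp flip: powr_add)
    also have "2 powr (- \<alpha> * real_of_int (i - K1)) * 2 powr (real CARD('n) * (1 - 1 / p) * real_of_int (i - K1)) = 2 powr (\<sigma>1 * real_of_int (i - K1))"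
      unfolding powr_add[symmetric] \<sigma>1_def by (rule arg_cong[where f = "\<lambda>x. 2 powr x"]) (simp add: algebra_simps)
    also have "2 powr (- \<alpha> * real_of_int (j - K2)) * 2 powr (real CARD('m) * (1 - 1 / p) * real_of_int (j - K2)) = 2 powr (\<sigma>2 * real_of_int (j - K2))"
      unfolding powr_add[symmetric] \<sigma>2_def by (rule arg_cong[where f = "\<lambda>x. 2 powr x"]) (simp add: algebra_simps)
    finally show ?thesis unfolding V_def .
  qed
  have "sum ?T F = sum ?T (F \<inter> ?G)"
  proof (rule sum.mono_neutral_right[OF F])
    show "\<forall>ij\<in>F - F \<inter> ?G. ?T ij = 0"
    proof
      fix ij assume ij: "ij \<in> F - F \<inter> ?G"
      obtain i j where eq: "ij = (i, j)" by (cases ij)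
      have "i > K1 \<or> j > K2" using ij eq by auto
      then show "?T ij = 0" unfolding eq by (rule zero)
    qed
  qed auto
  also have "\<dots> \<le> (\<Sum>(i, j)\<in>F \<inter> ?G. ennreal (V * (2 powr (\<sigma>1 * real_of_int (i - K1)) * 2 powr (\<sigma>2 * real_of_int (j - K2)))))"
  proof (rule sum_mono)
    fix ij assume ij: "ij \<in> F \<inter> ?G"
    obtain i j where eq: "ij = (i, j)" by (cases ij)
    show "?T ij \<le> (case ij of (i, j) \<Rightarrow> ennreal (V * (2 powr (\<sigma>1 * real_of_int (i - K1)) * 2 powr (\<sigma>2 * real_of_int (j - K2)))))"
      using bd[of i j] ij unfolding eq by simp
  qed
  also have "\<dots> = ennreal (V * (\<Sum>(i, j)\<in>F \<inter> ?G. 2 powr (\<sigma>1 * real_of_int (i - K1)) * 2 powr (\<sigma>2 * real_of_int (j - K2))))"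
    using V by (simp add: case_prod_unfold sum_distrib_left)
  also have "\<dots> \<le> ennreal (V * (geo \<sigma>1 * geo \<sigma>2))"
    using F \<sigma> V by (intro ennreal_leI mult_left_mono sum_pair_powr_le_geo) (auto simp: \<sigma>1_def \<sigma>2_def)
  finally show "sum ?T F \<le> ennreal (2 * (8 ^ (CARD('n) + CARD('m))) powr (1 - 1 / p) * (geo (real CARD('n) * (1 - 1 / p) - \<alpha>) * geo (real CARD('m) * (1 - 1 / p) - \<alpha>)) * E * (a * b))"
    unfolding V_def \<sigma>1_def \<sigma>2_def by (simp only: mult_ac)
qed (use g in auto)

end

text \<open>The John-Nirenberg argument needs a strictly positive real bound. This transfers its
  outcome to the extended-real norm: the value 0 is reached by letting the bound shrink, and
  infinity is trivial because \<open>C\<close> is positive.\<close>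

lemma ennreal_le_cmultI:
  assumes C: "C > 0" and le: "\<And>b. b > 0 \<Longrightarrow> X \<le> ennreal b \<Longrightarrow> Y \<le> ennreal (C * b)"
  shows "Y \<le> ennreal C * X"
proof (cases X)
  case (real x)
  have *: "Y \<le> ennreal (C * x) + ennreal e" if "e > 0" for e
  proof -
    have "Y \<le> ennreal (C * (x + e / C))"
      using real C that by (intro le) (auto intro!: ennreal_leI add_nonneg_pos)
    also have "C * (x + e / C) = C * x + e" using C by (simp add: distrib_left)
    also have "ennreal \<dots> = ennreal (C * x) + ennreal e" using real C that by (intro ennreal_plus) auto
    finally show ?thesis .
  qed
  have "Y \<le> ennreal (C * x)" by (rule ennreal_le_epsilon) (rule *)
  then show ?thesis using real C by (simp add: ennreal_mult)
next
  case top
  then show ?thesis using C by (simp add: ennreal_mult_top)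
qed

section \<open>Comparison of the two bmo norms\<close>

lemma rectangles_cases:
  fixes R :: "((real^'n) \<times> (real^'m)) set"
  assumes "R \<in> rectangles"
  obtains A :: "(real^'n) set" and B :: "(real^'m) set" and a b K1 K2
  where "R = A \<times> B" "shell_controlled A a K1" "shell_controlled B b K2" "measure lebesgue R = a * b"
proof -
  obtain x r y s where R: "R = cube x r \<times> cube y s" "r > 0" "s > 0"
    using assms unfolding rectangles_def by blast
  obtain K1 where K1: "shell_controlled (cube x r) (r ^ CARD('n)) K1" using shell_controlled_cube[OF R(2)] by blast
  obtain K2 where K2: "shell_controlled (cube y s) (s ^ CARD('m)) K2" using shell_controlled_cube[OF R(3)] by blast
  show thesis using that[OF R(1) K1 K2] R by (simp add: measure_rectangle)
qed

text \<open>Numerator and denominator carry the same factor \<open>W\<close> depending on the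
  rectangle; it cancels, which gives a bound uniform over all rectangles.\<close>

lemma bmo_morrey_herz_norm_le:
  fixes \<alpha> lam p q :: real
  assumes p: "1 < p" and q: "1 < q" and lam: "0 < lam"
    and "lam < \<alpha> + real CARD('n::finite) / p" "lam < \<alpha> + real CARD('m::finite) / p"
  shows "\<exists>C>0. \<forall>f \<in> (bmo :: ((real^'n) \<times> (real^'m) \<Rightarrow> complex) set).
    bmo_morrey_herz_norm \<alpha> lam p q f \<le> ennreal C * bmo_norm f"
proof -
  let ?n = "real CARD('n)" and ?m = "real CARD('m)"
  \<comment> \<open>For positive \<open>lam\<close>, the sums over shells converge once
    \<open>1 - 1 / t\<close> exceeds both quotients. These are below 1 by the upper bounds on
    \<open>lam\<close>, so the midpoint \<kappa> between \<kappa>0 and 1 gives a finite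
    \<open>t = 1 / (1 - \<kappa>)\<close>.\<close>
  define \<kappa>0 where "\<kappa>0 = max 0 (max ((lam - \<alpha>) * p / ?n) ((lam - \<alpha>) * p / ?m))"
  define \<kappa> where "\<kappa> = (\<kappa>0 + 1) / 2"
  have nm: "?n > 0" "?m > 0" by simp_all
  have "(lam - \<alpha>) * p / ?n < 1" "(lam - \<alpha>) * p / ?m < 1"
  proof -
    have "lam - \<alpha> < ?n / p" "lam - \<alpha> < ?m / p" using assms by linarith+
    then have "(lam - \<alpha>) * p < ?n" "(lam - \<alpha>) * p < ?m" using p by (simp_all only: pos_less_divide_eq)
    then show "(lam - \<alpha>) * p / ?n < 1" "(lam - \<alpha>) * p / ?m < 1" by simp_all
  qed
  then have "\<kappa>0 < 1" by (simp only: \<kappa>0_def max_less_iff_conj) simp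
  then have \<kappa>: "0 < \<kappa>" "\<kappa> < 1" "(lam - \<alpha>) * p / ?n < \<kappa>" "(lam - \<alpha>) * p / ?m < \<kappa>"
  proof -
    assume 1: "\<kappa>0 < 1"
    have le: "0 \<le> \<kappa>0" "(lam - \<alpha>) * p / ?n \<le> \<kappa>0" "(lam - \<alpha>) * p / ?m \<le> \<kappa>0"
      unfolding \<kappa>0_def by linarith+
    show "0 < \<kappa>" "\<kappa> < 1" using 1 le(1) by (simp_all add: \<kappa>_def)
    have mid: "u < (v + 1) / 2" if "v < 1" "u \<le> v" for u v :: real using that by (simp add: field_simps)
    show "(lam - \<alpha>) * p / ?n < \<kappa>" "(lam - \<alpha>) * p / ?m < \<kappa>"
      unfolding \<kappa>_def by (rule mid[OF 1 le(2)], rule mid[OF 1 le(3)])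
  qed
  define t where "t = 1 / (1 - \<kappa>)"
  have t: "t > 1" "1 - 1 / t = \<kappa>" using \<kappa> by (simp_all add: t_def)
  have \<rho>: "\<alpha> + ?n * (1 - 1 / t) / p - lam > 0" "\<alpha> + ?m * (1 - 1 / t) / p - lam > 0"
  proof -
    have "(lam - \<alpha>) * p < ?n * \<kappa>" "(lam - \<alpha>) * p < ?m * \<kappa>"
      using \<kappa>(3,4) nm by (simp_all only: pos_divide_less_eq mult.commute)
    then have "lam - \<alpha> < ?n * \<kappa> / p" "lam - \<alpha> < ?m * \<kappa> / p"
      using p by (simp_all add: pos_less_divide_eq)
    then show "\<alpha> + ?n * (1 - 1 / t) / p - lam > 0" "\<alpha> + ?m * (1 - 1 / t) / p - lam > 0"
      unfolding t(2) by linarith+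
  qed
  \<comment> \<open>\<open>c\<close> is the constant of \<open>morrey_herz_indicator_ge\<close>,
    \<open>c0\<close> that of \<open>bmo_integral_powr_le\<close> at the exponent
    \<open>p * t\<close>, and \<open>C1\<close> collects the factors of
    \<open>morrey_herz_le_integral_powr\<close>.\<close>
  define c where "c = 2 powr (- 2 * \<bar>\<alpha>\<bar>) * (1 / 1024) powr (1 / p)"
  define c0 where "c0 = 4 * (p * t * (4 + 2 ^ CARD('n) * 2 ^ CARD('m)) / ln 2) powr (p * t)"
  define C1 where "C1 = (geo (q * (\<alpha> + ?n * (1 - 1 / t) / p - lam)) * geo (q * (\<alpha> + ?m * (1 - 1 / t) / p - lam))) powr (1 / q)
         * (2 * (8 ^ (CARD('n) + CARD('m))) powr (1 - 1 / t)) powr (1 / p) * c0 powr (1 / (p * t))"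
  have c: "c > 0" by (simp add: c_def)
  have "4 + 2 ^ CARD('n) * 2 ^ CARD('m) > (0 :: real)" by (intro add_pos_pos) auto
  then have c0: "c0 > 0" using p t by (simp add: c0_def)
  have "geo (q * (\<alpha> + ?n * (1 - 1 / t) / p - lam)) > 0" "geo (q * (\<alpha> + ?m * (1 - 1 / t) / p - lam)) > 0"
    using q \<rho> by (intro geo_pos mult_pos_pos; simp)+
  then have C1: "C1 > 0" unfolding C1_def using c0 by (intro mult_pos_pos) auto
  have "bmo_morrey_herz_norm \<alpha> lam p q f \<le> ennreal (C1 / c * d)"
    if f: "locally_integrable f" "bmo_norm f \<le> ennreal d" and d: "d > 0"
    for f :: "(real^'n) \<times> (real^'m) \<Rightarrow> complex" and d
    unfolding bmo_morrey_herz_norm_def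
  proof (rule SUP_least)
    fix R :: "((real^'n) \<times> (real^'m)) set" assume R: "R \<in> rectangles"
    obtain A :: "(real^'n) set" and B :: "(real^'m) set" and a b K1 K2
      where AB: "R = A \<times> B" and A: "shell_controlled A a K1" and B: "shell_controlled B b K2"
        and vol: "measure lebesgue R = a * b"
      using rectangles_cases[OF R] by metis
    define W where "W = (a * b) powr (1 / p) * 2 powr (real_of_int (K1 + K2) * (\<alpha> - lam))"
    have ab: "a > 0" "b > 0" using A B by (simp_all add: shell_controlled_def)
    have W: "W > 0" using ab by (simp add: W_def)
    let ?g = "\<lambda>z. f z - average R f"
    have "morrey_herz_norm \<alpha> lam p q (cut (A \<times> B) ?g)
     \<le> ennreal ((geo (q * (\<alpha> + ?n * (1 - 1 / t) / p - lam)) * geo (q * (\<alpha> + ?m * (1 - 1 / t) / p - lam))) powr (1 / q)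
         * (2 * (8 ^ (CARD('n) + CARD('m))) powr (1 - 1 / t)) powr (1 / p) * (c0 * d powr (p * t)) powr (1 / (p * t))
         * ((a * b) powr (1 / p) * 2 powr (real_of_int (K1 + K2) * (\<alpha> - lam))))"
    proof (rule morrey_herz_le_integral_powr[OF A B p q lam _ t(1) _ _ \<rho>])
      show "(\<lambda>z. indicator (A \<times> B) z * norm (?g z)) \<in> borel_measurable lebesgue"
        using set_integrable_norm[OF set_integrable_minus_average[OF f(1) R]] by (simp add: set_integrable_def AB)
      show "(\<integral>\<^sup>+z. ennreal (indicator (A \<times> B) z * norm (?g z) powr (p * t)) \<partial>lebesgue) \<le> ennreal (c0 * d powr (p * t) * (a * b))"
        unfolding vol[symmetric] c0_def AB[symmetric]
        by (rule bmo_integral_powr_le[OF f d R]) (use p t in simp)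
      show "c0 * d powr (p * t) > 0" using c0 d by simp
    qed
    \<comment> \<open>The root undoes the power \<open>p * t\<close> of \<open>d\<close>, so the
      final bound is linear in the bmo norm.\<close>
    also have "(c0 * d powr (p * t)) powr (1 / (p * t)) = c0 powr (1 / (p * t)) * d"
      using p t d by (simp add: powr_mult powr_powr)
    finally have up: "morrey_herz_norm \<alpha> lam p q (cut R ?g) \<le> ennreal (C1 * d * W)"
      unfolding AB C1_def W_def by (simp only: mult_ac)
    have low: "ennreal (c * W) \<le> morrey_herz_norm \<alpha> lam p q (indicator R :: _ \<Rightarrow> real)"
      using morrey_herz_indicator_ge[OF A B p q lam, of \<alpha>] unfolding AB c_def W_def .
    show "morrey_herz_norm \<alpha> lam p q (cut R ?g) / morrey_herz_norm \<alpha> lam p q (indicator R :: _ \<Rightarrow> real) \<le> ennreal (C1 / c * d)"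
    proof (rule divide_le_posI_ennreal)
      have "C1 * d * W = c * W * (C1 / c * d)" using c by simp
      then have "ennreal (C1 * d * W) = ennreal (c * W) * ennreal (C1 / c * d)"
        using C1 d W c by (simp flip: ennreal_mult)
      also have "\<dots> \<le> morrey_herz_norm \<alpha> lam p q (indicator R :: _ \<Rightarrow> real) * ennreal (C1 / c * d)"
        by (rule mult_right_mono[OF low]) simp
      finally show "morrey_herz_norm \<alpha> lam p q (cut R ?g) \<le> morrey_herz_norm \<alpha> lam p q (indicator R :: _ \<Rightarrow> real) * ennreal (C1 / c * d)"
        using up by (rule order_trans[rotated])
      show "0 < morrey_herz_norm \<alpha> lam p q (indicator R :: _ \<Rightarrow> real)"
        using c W by (intro less_le_trans[OF _ low]) simp
    qed
  qed
  then show ?thesis using C1 c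
    by (intro exI[of _ "C1 / c"]) (auto simp: bmo_def intro!: ennreal_le_cmultI)
qed

text \<open>The upper estimate of the denominator turns a bound on the quotient into one on the
  numerator, and \<open>integral_le_morrey_herz\<close> turns that into mean oscillation. Local
  integrability alone suffices, since the Morrey-Herz bound is the starting point.\<close>

lemma bmo_norm_le_morrey_herz:
  fixes \<alpha> lam p q :: real
  assumes p: "1 < p" and q: "1 < q" and lam: "0 < lam"
    and \<rho>: "lam < \<alpha> + real CARD('n::finite) / p" "lam < \<alpha> + real CARD('m::finite) / p"
    and \<sigma>: "\<alpha> < real CARD('n) * (1 - 1 / p)" "\<alpha> < real CARD('m) * (1 - 1 / p)"
  shows "\<exists>C>0. \<forall>f :: (real^'n) \<times> (real^'m) \<Rightarrow> complex. locally_integrable f \<longrightarrow>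
    bmo_norm f \<le> ennreal C * bmo_morrey_herz_norm \<alpha> lam p q f"
proof -
  let ?n = "real CARD('n)" and ?m = "real CARD('m)"
  define C1 where "C1 = (geo (q * (\<alpha> + ?n / p - lam)) * geo (q * (\<alpha> + ?m / p - lam))) powr (1 / q) * (8 ^ (CARD('n) + CARD('m))) powr (1 / p)"
  define C2 where "C2 = 2 * (8 ^ (CARD('n) + CARD('m))) powr (1 - 1 / p) * (geo (?n * (1 - 1 / p) - \<alpha>) * geo (?m * (1 - 1 / p) - \<alpha>))"
  have "geo (q * (\<alpha> + ?n / p - lam)) > 0" "geo (q * (\<alpha> + ?m / p - lam)) > 0"
    using q \<rho> by (intro geo_pos mult_pos_pos; simp)+
  then have C1: "C1 > 0" by (simp add: C1_def)
  have "geo (?n * (1 - 1 / p) - \<alpha>) > 0" "geo (?m * (1 - 1 / p) - \<alpha>) > 0"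
    using \<sigma> by (intro geo_pos; simp)+
  then have C2: "C2 > 0" by (simp add: C2_def)
  have "bmo_norm f \<le> ennreal (C2 * C1 * d)"
    if f: "locally_integrable f" and le: "bmo_morrey_herz_norm \<alpha> lam p q f \<le> ennreal d" and d: "d > 0"
    for f :: "(real^'n) \<times> (real^'m) \<Rightarrow> complex" and d
  proof (subst bmo_norm_le_iff[OF f])
    show "\<forall>R\<in>rectangles. (LINT z:R|lebesgue. norm (f z - average R f)) \<le> C2 * C1 * d * measure lebesgue R"
    proof
      fix R :: "((real^'n) \<times> (real^'m)) set" assume R: "R \<in> rectangles"
      obtain A :: "(real^'n) set" and B :: "(real^'m) set" and a b K1 K2
        where AB: "R = A \<times> B" and A: "shell_controlled A a K1" and B: "shell_controlled B b K2"
          and vol: "measure lebesgue R = a * b"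
        using rectangles_cases[OF R] by metis
      define W where "W = (a * b) powr (1 / p) * 2 powr (real_of_int (K1 + K2) * (\<alpha> - lam))"
      have ab: "a > 0" "b > 0" using A B by (simp_all add: shell_controlled_def)
      have W: "W > 0" using ab by (simp add: W_def)
      let ?g = "\<lambda>z. f z - average R f"
      let ?N = "morrey_herz_norm \<alpha> lam p q (indicator R :: _ \<Rightarrow> real)"
      have up: "?N \<le> ennreal (C1 * W)"
        using morrey_herz_indicator_le[OF A B p q lam \<rho>] unfolding AB C1_def W_def .
      have low: "0 < ?N"
        using morrey_herz_indicator_ge[OF A B p q lam, of \<alpha>] ab unfolding AB
        by (intro less_le_trans[OF _ morrey_herz_indicator_ge[OF A B p q lam, of \<alpha>]]) simp
      have "?N < top" using up ennreal_less_top order_le_less_trans by blast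
      have "morrey_herz_norm \<alpha> lam p q (cut R ?g) / ?N \<le> bmo_morrey_herz_norm \<alpha> lam p q f"
        unfolding bmo_morrey_herz_norm_def using R by (rule SUP_upper)
      also note le
      finally have "morrey_herz_norm \<alpha> lam p q (cut R ?g) / ?N * ?N \<le> ennreal d * ?N" by (rule mult_right_mono) simp
      also have "\<dots> \<le> ennreal d * ennreal (C1 * W)" by (intro mult_left_mono up) simp
      also have "\<dots> = ennreal (C1 * d * W)" using d C1 W by (simp flip: ennreal_mult add: mult_ac)
      \<comment> \<open>Multiplying the quotient back is legitimate only because the denominator is
        neither 0 nor infinite.\<close>
      also have "morrey_herz_norm \<alpha> lam p q (cut R ?g) / ?N * ?N = morrey_herz_norm \<alpha> lam p q (cut R ?g)"
        using low \<open>?N < top\<close> by (simp add: ennreal_divide_times ennreal_mult_divide_eq)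
      finally have le': "morrey_herz_norm \<alpha> lam p q (cut (A \<times> B) ?g)
         \<le> ennreal (C1 * d * ((a * b) powr (1 / p) * 2 powr (real_of_int (K1 + K2) * (\<alpha> - lam))))"
        unfolding AB W_def .
      have int: "set_integrable lebesgue R (\<lambda>z. norm (?g z))"
        using set_integrable_minus_average[OF f R] by (rule set_integrable_norm)
      then have meas: "(\<lambda>z. indicator (A \<times> B) z * norm (?g z)) \<in> borel_measurable lebesgue"
        by (simp add: set_integrable_def AB)
      have "ennreal (LINT z:R|lebesgue. norm (?g z)) = (\<integral>\<^sup>+z. ennreal (indicator (A \<times> B) z * norm (?g z)) \<partial>lebesgue)"
        unfolding set_lebesgue_integral_def using int
        by (subst nn_integral_eq_integral) (auto simp: set_integrable_def AB)
      also have "\<dots> \<le> ennreal (C2 * (C1 * d) * (a * b))"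
        unfolding C2_def
        by (rule integral_le_morrey_herz[OF A B p q lam meas _ le']) (use C1 d \<sigma> in auto)
      finally show "(LINT z:R|lebesgue. norm (?g z)) \<le> C2 * C1 * d * measure lebesgue R"
        unfolding vol using C1 C2 d ab by (subst (asm) ennreal_le_iff) (auto simp: mult_ac)
    qed
  qed (use C1 C2 d in auto)
  then show ?thesis using C1 C2
    by (intro exI[of _ "C2 * C1"]) (auto intro!: ennreal_le_cmultI)
qed

theorem theorem5p4:
  fixes \<alpha> lam p q :: real
  assumes "1 < p" and "1 < q"
    and "0 < lam" and "lam < min (\<alpha> + real CARD('n::finite) / p) (\<alpha> + real CARD('m::finite) / p)"
    and "max (- (real CARD('n) / p)) (- (real CARD('m) / p)) < \<alpha>"
    and "\<alpha> < min (real CARD('n) * (1 - 1 / p)) (real CARD('m) * (1 - 1 / p))"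
  shows "\<exists>C::real. C \<ge> 1 \<and>
    (\<forall>f \<in> (bmo :: ((real^'n) \<times> (real^'m) \<Rightarrow> complex) set).
       ennreal (1 / C) * bmo_norm f \<le> bmo_morrey_herz_norm \<alpha> lam p q f \<and>
       bmo_morrey_herz_norm \<alpha> lam p q f \<le> ennreal C * bmo_norm f)"
proof -
  obtain C1 where C1: "C1 > 0" "\<And>f. f \<in> (bmo :: ((real^'n) \<times> (real^'m) \<Rightarrow> complex) set) \<Longrightarrow>
      bmo_morrey_herz_norm \<alpha> lam p q f \<le> ennreal C1 * bmo_norm f"
    using bmo_morrey_herz_norm_le[where 'n = 'n and 'm = 'm, of p q lam \<alpha>] assms by auto
  obtain C2 where C2: "C2 > 0" "\<And>f :: (real^'n) \<times> (real^'m) \<Rightarrow> complex. locally_integrable f \<Longrightarrow>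
      bmo_norm f \<le> ennreal C2 * bmo_morrey_herz_norm \<alpha> lam p q f"
    using bmo_norm_le_morrey_herz[where 'n = 'n and 'm = 'm, of p q lam \<alpha>] assms by auto
  define C where "C = max 1 (max C1 C2)"
  have C: "C \<ge> 1" "C1 \<le> C" "C2 \<le> C" by (auto simp: C_def)
  have "ennreal (1 / C) * bmo_norm f \<le> bmo_morrey_herz_norm \<alpha> lam p q f \<and>
       bmo_morrey_herz_norm \<alpha> lam p q f \<le> ennreal C * bmo_norm f"
    if f: "f \<in> bmo" for f :: "(real^'n) \<times> (real^'m) \<Rightarrow> complex"
  proof
    have "ennreal (1 / C) * bmo_norm f \<le> ennreal (1 / C) * (ennreal C * bmo_morrey_herz_norm \<alpha> lam p q f)"
      using C2(2)[of f] f C by (intro mult_left_mono order_trans[OF C2(2)] mult_right_mono ennreal_leI) (auto simp: bmo_def)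
    also have "\<dots> = bmo_morrey_herz_norm \<alpha> lam p q f"
      using C by (simp add: mult.assoc[symmetric] flip: ennreal_mult)
    finally show "ennreal (1 / C) * bmo_norm f \<le> bmo_morrey_herz_norm \<alpha> lam p q f" .
    show "bmo_morrey_herz_norm \<alpha> lam p q f \<le> ennreal C * bmo_norm f"
      using C by (intro order_trans[OF C1(2)[OF f]] mult_right_mono ennreal_leI) auto
  qed
  then show ?thesis using C by blast
qed

end
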